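(* Let $h:\Omega\to\Omega'$ be an orbit equivalence between two minimal, aperiodic tiling spaces in $\mathbb{R}^d$ (with or without finite local complexity), with $\Omega$ uniquely ergodic with invariant probability measure $\mu$. Then the $d\times d$ matrix $C_\mu[h]$ is invertible.
   Context: **Tiling spaces.** A tile is a convex polytope in $\mathbb{R}^d$ with non-empty interior, possibly carrying a label in a compact metric space; the set of prototiles (tiles up to translation) is compact. A tiling is a collection of tiles covering $\mathbb{R}^d$, any two of which meet only along their boundaries. A Delone set is a uniformly discrete and relatively dense subset of $\mathbb{R}^d$, possibly labelled. Tilings and labelled Delone sets are used interchangeably. $\mathbb{R}^d$ acts by translation, $T\mapsto T-x$. Two tilings (Delone sets) are $\varepsilon$-close if on a ball of radius about $1/\varepsilon$ around the origin there is a one-to-one correspondence between their tiles (points), corresponding tiles being $\varepsilon$-close in Hausdorff distance (points being $\varepsilon$-close) with $\varepsilon$-close labels. A tiling space is a compact translation-invariant set of tilings (or labelled Delone sets). It is minimal if every $\mathbb{R}^d$-orbit is dense, aperiodic if $T-x=T$ implies $x=0$ for each of its elements, uniquely ergodic if it carries exactly one translation-invariant Borel probability measure. It has finite local complexity if for each $R$ its elements have finitely many patches of radius $R$ up to translation. **Weak cohomology and class of an orbit equivalence.** An orbit equivalence is a homeomorphism sending $\mathbb{R}^d$-orbits to $\mathbb{R}^d$-orbits. A weak 1-cocycle is a continuous $\alpha:\Omega\times\mathbb{R}^d\to\mathbb{R}^d$ with $\alpha(T,x)+\alpha(T-x,y)=\alpha(T,x+y)$; it is a weak coboundary if $\alpha(T,v)=s(T-v)-s(T)$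 with $s:\Omega\to\mathbb{R}^d$ continuous. $H^1_w(\Omega;\mathbb{R}^d)$ is the quotient. For an orbit equivalence $h:\Omega\to\Omega'$, define $h_T(x)$ by $h(T-x)=h(T)-h_T(x)$ (well-defined by aperiodicity); $[h]\in H^1_w(\Omega;\mathbb{R}^d)$ is the class of $(T,v)\mapsto h_T(v)$. (With finite local complexity there is also a strong class of $h$; it maps to this weak class under the natural map from strong to weak cohomology, and $C_\mu$ is compatible with that map.) **Ruelle–Sullivan map.** $C_\mu([\alpha])$ is the linear map $v\mapsto\int_\Omega\alpha(T,v)\,d\mu(T)=\lim_{r\to\infty}r^{-d}\int_{C_r}\alpha(T-s,v)\,ds$ (any $T\in\Omega$), with $C_r=[-r/2,r/2]^d$; it depends only on the class of $\alpha$. *)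

theory Defs
  imports "HOL-Analysis.Analysis"
begin

text \<open>
  A tiling and a labelled Delone set are both rendered as a set of labelled pieces, a piece being
  a subset of the space paired with its label.  For a tiling the subsets are the tiles, for a
  Delone set they are the singletons \<open>{x}\<close>, on which the Hausdorff distance is the distance of the
  points.  Absence of labels is the case of a constant label.
\<close>

type_synonym ('n, 'l) piece = "(real^'n) set \<times> 'l"
type_synonym ('n, 'l) pattern = "('n, 'l) piece set"

definition shift :: "real^'n \<Rightarrow> ('n::finite, 'l) piece \<Rightarrow> ('n, 'l) piece" where
  "shift x p = ((\<lambda>y. y - x) ` fst p, snd p)"

definition translate :: "('n::finite, 'l) pattern \<Rightarrow> real^'n \<Rightarrow> ('n, 'l) pattern" where
  "translate T x = shift x ` T"

definition orbit :: "('n::finite, 'l) pattern \<Rightarrow> ('n, 'l) pattern set" where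
  "orbit T = range (translate T)"

definition hausdorff_dist :: "'a::metric_space set \<Rightarrow> 'a set \<Rightarrow> real" where
  "hausdorff_dist A B = max (SUP a\<in>A. infdist a B) (SUP b\<in>B. infdist b A)"

definition piece_dist :: "('n::finite, 'l::metric_space) piece \<Rightarrow> ('n, 'l) piece \<Rightarrow> real" where
  "piece_dist p q = max (hausdorff_dist (fst p) (fst q)) (dist (snd p) (snd q))"


definition is_tile :: "(real^'n::finite) set \<Rightarrow> bool" where
  "is_tile t \<longleftrightarrow> polytope t \<and> interior t \<noteq> {}"

definition is_tiling :: "('n::finite, 'l) pattern \<Rightarrow> bool" where
  "is_tiling T \<longleftrightarrow>
     (\<forall>p\<in>T. is_tile (fst p)) \<and>
     (\<Union>p\<in>T. fst p) = UNIV \<and>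
     (\<forall>p\<in>T. \<forall>q\<in>T. p \<noteq> q \<longrightarrow> fst p \<inter> fst q \<subseteq> frontier (fst p) \<inter> frontier (fst q))"

definition uniformly_discrete :: "'a::metric_space set \<Rightarrow> bool" where
  "uniformly_discrete X \<longleftrightarrow> (\<exists>r>0. \<forall>x\<in>X. \<forall>y\<in>X. x \<noteq> y \<longrightarrow> r \<le> dist x y)"

definition relatively_dense :: "'a::metric_space set \<Rightarrow> bool" where
  "relatively_dense X \<longleftrightarrow> (\<exists>R. \<forall>y. \<exists>x\<in>X. dist x y \<le> R)"

definition is_labelled_delone :: "('n::finite, 'l) pattern \<Rightarrow> bool" where
  "is_labelled_delone T \<longleftrightarrow>
     (\<exists>X lab. uniformly_discrete X \<and> relatively_dense X \<and> T = (\<lambda>x. ({x}, lab x)) ` X)"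


text \<open>
  Closeness of patterns: a bijection between subpatterns that contain at least all pieces meeting
  the ball of radius \<open>1/\<epsilon>\<close>, matching pieces that are \<open>\<epsilon>\<close>-close in shape and label.  Requiring the
  two sides to be exactly the pieces meeting the ball would be too rigid, since a piece may
  leave the ball under an arbitrarily small perturbation.
\<close>

definition close :: "real \<Rightarrow> ('n::finite, 'l::metric_space) pattern \<Rightarrow> ('n, 'l) pattern \<Rightarrow> bool" where
  "close \<epsilon> S T \<longleftrightarrow>
     (\<exists>A B f. A \<subseteq> S \<and> B \<subseteq> T \<and> bij_betw f A B \<and>
        (\<forall>p\<in>S. fst p \<inter> cball 0 (1/\<epsilon>) \<noteq> {} \<longrightarrow> p \<in> A) \<and>
        (\<forall>q\<in>T. fst q \<inter> cball 0 (1/\<epsilon>) \<noteq> {} \<longrightarrow> q \<in> B) \<and>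
        (\<forall>p\<in>A. piece_dist p (f p) < \<epsilon>))"

definition pattern_topology ::
  "('n::finite, 'l::metric_space) pattern set \<Rightarrow> ('n, 'l) pattern topology" where
  "pattern_topology \<Omega> =
     topology (\<lambda>U. U \<subseteq> \<Omega> \<and> (\<forall>T\<in>U. \<exists>\<epsilon>>0. \<forall>S\<in>\<Omega>. close \<epsilon> T S \<longrightarrow> S \<in> U))"

lemma close_mono:
  fixes S T :: "('n::finite, 'l::metric_space) pattern"
  assumes "close \<delta> S T" "0 < \<delta>" "\<delta> \<le> \<epsilon>"
  shows "close \<epsilon> S T"
proof -
  have "1/\<epsilon> \<le> 1/\<delta>"
    using assms by (simp add: frac_le)
  then have sub: "cball (0::real^'n) (1/\<epsilon>) \<subseteq> cball 0 (1/\<delta>)"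
    by (rule subset_cball)
  obtain A B f where *: "A \<subseteq> S" "B \<subseteq> T" "bij_betw f A B"
    "\<forall>p\<in>S. fst p \<inter> cball 0 (1/\<delta>) \<noteq> {} \<longrightarrow> p \<in> A"
    "\<forall>q\<in>T. fst q \<inter> cball 0 (1/\<delta>) \<noteq> {} \<longrightarrow> q \<in> B"
    "\<forall>p\<in>A. piece_dist p (f p) < \<delta>"
    using assms(1) unfolding close_def by blast
  have meets: "t \<inter> cball 0 (1/\<delta>) \<noteq> {}" if "t \<inter> cball 0 (1/\<epsilon>) \<noteq> {}" for t :: "(real^'n) set"
    using that sub by blast
  have "\<forall>p\<in>S. fst p \<inter> cball 0 (1/\<epsilon>) \<noteq> {} \<longrightarrow> p \<in> A"
    using *(4) meets by simp
  moreover have "\<forall>q\<in>T. fst q \<inter> cball 0 (1/\<epsilon>) \<noteq> {} \<longrightarrow> q \<in> B"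
    using *(5) meets by simp
  moreover have "\<forall>p\<in>A. piece_dist p (f p) < \<epsilon>"
    using *(6) assms(3) by force
  ultimately show ?thesis
    unfolding close_def using *(1-3) by (intro exI[of _ A] exI[of _ B] exI[of _ f] conjI)
qed

lemma openin_pattern_topology:
  "openin (pattern_topology \<Omega>) U \<longleftrightarrow>
     U \<subseteq> \<Omega> \<and> (\<forall>T\<in>U. \<exists>\<epsilon>>0. \<forall>S\<in>\<Omega>. close \<epsilon> T S \<longrightarrow> S \<in> U)"
proof -
  let ?P = "\<lambda>U. U \<subseteq> \<Omega> \<and> (\<forall>T\<in>U. \<exists>\<epsilon>>0. \<forall>S\<in>\<Omega>. close \<epsilon> T S \<longrightarrow> S \<in> U)"
  have "?P (U \<inter> V)" if U: "?P U" and V: "?P V" for U V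
  proof (intro conjI ballI)
    show "U \<inter> V \<subseteq> \<Omega>" using U by blast
    fix T assume "T \<in> U \<inter> V"
    then obtain \<delta> \<epsilon> where "\<delta> > 0" "\<forall>S\<in>\<Omega>. close \<delta> T S \<longrightarrow> S \<in> U"
      and "\<epsilon> > 0" "\<forall>S\<in>\<Omega>. close \<epsilon> T S \<longrightarrow> S \<in> V"
      using U V unfolding Int_iff by metis
    then show "\<exists>\<epsilon>>0. \<forall>S\<in>\<Omega>. close \<epsilon> T S \<longrightarrow> S \<in> U \<inter> V"
      using close_mono[of "min \<delta> \<epsilon>" T _ \<delta>] close_mono[of "min \<delta> \<epsilon>" T _ \<epsilon>]
      by (intro exI[of _ "min \<delta> \<epsilon>"]) simp
  qed
  moreover have "?P (\<Union>K)" if "\<forall>U\<in>K. ?P U" for K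
  proof (intro conjI ballI)
    show "\<Union>K \<subseteq> \<Omega>" using that by (intro Union_least) simp
    fix T assume "T \<in> \<Union>K"
    then obtain U where "U \<in> K" "T \<in> U" by (rule UnionE)
    with that obtain \<epsilon> where "\<epsilon> > 0" "\<forall>S\<in>\<Omega>. close \<epsilon> T S \<longrightarrow> S \<in> U"
      by metis
    with \<open>U \<in> K\<close> show "\<exists>\<epsilon>>0. \<forall>S\<in>\<Omega>. close \<epsilon> T S \<longrightarrow> S \<in> \<Union>K"
      by (intro exI[of _ \<epsilon>]) auto
  qed
  ultimately have "istopology ?P"
    unfolding istopology_def by simp
  then show ?thesis
    by (simp add: pattern_topology_def topology_inverse')
qed

lemma topspace_pattern_topology [simp]: "topspace (pattern_topology \<Omega>) = \<Omega>"
proof -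
  have "openin (pattern_topology \<Omega>) \<Omega>"
    unfolding openin_pattern_topology by (simp add: gt_ex)
  then show ?thesis
    by (metis openin_pattern_topology openin_topspace openin_subset subset_antisym)
qed


text \<open>
  Compactness of the set of prototiles is expressed by a compact set \<open>P\<close> of representatives:
  the labelled tiles occurring in \<open>\<Omega>\<close> are exactly the translates of members of \<open>P\<close>.
\<close>

definition compact_prototiles :: "('n::finite, 'l::metric_space) pattern set \<Rightarrow> bool" where
  "compact_prototiles \<Omega> \<longleftrightarrow>
     (\<exists>P. compact_space (Metric_space.mtopology P piece_dist) \<and> \<Union>\<Omega> = (\<Union>x. shift x ` P))"

definition compact_labels :: "('n::finite, 'l::metric_space) pattern set \<Rightarrow> bool" where
  "compact_labels \<Omega> \<longleftrightarrow> (\<exists>L. compact L \<and> snd ` \<Union>\<Omega> \<subseteq> L)"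

definition tiling_space :: "('n::finite, 'l::metric_space) pattern set \<Rightarrow> bool" where
  "tiling_space \<Omega> \<longleftrightarrow>
     ((\<forall>T\<in>\<Omega>. is_tiling T) \<and> compact_prototiles \<Omega> \<or> (\<forall>T\<in>\<Omega>. is_labelled_delone T)) \<and>
     compact_labels \<Omega> \<and>
     compact_space (pattern_topology \<Omega>) \<and>
     (\<forall>T\<in>\<Omega>. \<forall>x. translate T x \<in> \<Omega>)"

definition minimal :: "('n::finite, 'l::metric_space) pattern set \<Rightarrow> bool" where
  "minimal \<Omega> \<longleftrightarrow> (\<forall>T\<in>\<Omega>. pattern_topology \<Omega> closure_of orbit T = \<Omega>)"

definition aperiodic :: "('n::finite, 'l) pattern set \<Rightarrow> bool" where
  "aperiodic \<Omega> \<longleftrightarrow> (\<forall>T\<in>\<Omega>. \<forall>x. translate T x = T \<longrightarrow> x = 0)"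

definition invariant_prob ::
  "('n::finite, 'l::metric_space) pattern set \<Rightarrow> ('n, 'l) pattern measure \<Rightarrow> bool" where
  "invariant_prob \<Omega> \<mu> \<longleftrightarrow>
     space \<mu> = \<Omega> \<and>
     sets \<mu> = sigma_sets \<Omega> {U. openin (pattern_topology \<Omega>) U} \<and>
     emeasure \<mu> \<Omega> = 1 \<and>
     (\<forall>x. \<forall>A\<in>sets \<mu>. emeasure \<mu> ((\<lambda>T. translate T x) ` A) = emeasure \<mu> A)"

definition uniquely_ergodic :: "('n::finite, 'l::metric_space) pattern set \<Rightarrow> bool" where
  "uniquely_ergodic \<Omega> \<longleftrightarrow> (\<exists>!\<mu>. invariant_prob \<Omega> \<mu>)"


type_synonym ('n, 'l) cochain = "('n, 'l) pattern \<Rightarrow> real^'n \<Rightarrow> real^'n"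

definition weak_cocycle ::
  "('n::finite, 'l::metric_space) pattern set \<Rightarrow> ('n, 'l) cochain \<Rightarrow> bool" where
  "weak_cocycle \<Omega> \<alpha> \<longleftrightarrow>
     continuous_map (prod_topology (pattern_topology \<Omega>) euclidean) euclidean (\<lambda>(T, x). \<alpha> T x) \<and>
     (\<forall>T\<in>\<Omega>. \<forall>x y. \<alpha> T x + \<alpha> (translate T x) y = \<alpha> T (x + y))"

definition weak_coboundary ::
  "('n::finite, 'l::metric_space) pattern set \<Rightarrow> ('n, 'l) cochain \<Rightarrow> bool" where
  "weak_coboundary \<Omega> \<alpha> \<longleftrightarrow>
     (\<exists>s. continuous_map (pattern_topology \<Omega>) euclidean s \<and>
          (\<forall>T\<in>\<Omega>. \<forall>v. \<alpha> T v = s (translate T v) - s T))"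

definition cohomologous ::
  "('n::finite, 'l::metric_space) pattern set \<Rightarrow> (('n, 'l) cochain \<times> ('n, 'l) cochain) set" where
  "cohomologous \<Omega> =
     {(\<alpha>, \<beta>). weak_cocycle \<Omega> \<alpha> \<and> weak_cocycle \<Omega> \<beta> \<and> weak_coboundary \<Omega> (\<lambda>T v. \<beta> T v - \<alpha> T v)}"

definition weak_cohomology ::
  "('n::finite, 'l::metric_space) pattern set \<Rightarrow> ('n, 'l) cochain set set" where
  "weak_cohomology \<Omega> = {\<alpha>. weak_cocycle \<Omega> \<alpha>} // cohomologous \<Omega>"

lemma equiv_cohomologous: "equiv {\<alpha>. weak_cocycle \<Omega> \<alpha>} (cohomologous \<Omega>)"
proof (rule equivI)
  show "cohomologous \<Omega> \<subseteq> {\<alpha>. weak_cocycle \<Omega> \<alpha>} \<times> {\<alpha>. weak_cocycle \<Omega> \<alpha>}"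
    unfolding cohomologous_def by auto
  show "refl_on {\<alpha>. weak_cocycle \<Omega> \<alpha>} (cohomologous \<Omega>)"
    unfolding refl_on_def cohomologous_def weak_coboundary_def
    by (auto intro!: exI[of _ "\<lambda>_. 0"])
  show "sym (cohomologous \<Omega>)"
  proof (rule symI)
    fix \<alpha> \<beta> assume "(\<alpha>, \<beta>) \<in> cohomologous \<Omega>"
    then obtain s where co: "weak_cocycle \<Omega> \<alpha>" "weak_cocycle \<Omega> \<beta>"
      and s: "continuous_map (pattern_topology \<Omega>) euclidean s"
        "\<forall>T\<in>\<Omega>. \<forall>v. \<beta> T v - \<alpha> T v = s (translate T v) - s T"
      unfolding cohomologous_def weak_coboundary_def by blast
    have "continuous_map (pattern_topology \<Omega>) euclidean (\<lambda>T. - s T)"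
      using s(1) by (rule continuous_map_minus)
    moreover have "\<forall>T\<in>\<Omega>. \<forall>v. \<alpha> T v - \<beta> T v = - s (translate T v) - - s T"
    proof (intro ballI allI)
      fix T v assume "T \<in> \<Omega>"
      then have "\<beta> T v - \<alpha> T v = s (translate T v) - s T"
        using s(2) by blast
      then show "\<alpha> T v - \<beta> T v = - s (translate T v) - - s T"
        by (simp add: algebra_simps)
    qed
    ultimately have "weak_coboundary \<Omega> (\<lambda>T v. \<alpha> T v - \<beta> T v)"
      unfolding weak_coboundary_def by (intro exI[of _ "\<lambda>T. - s T"] conjI)
    with co show "(\<beta>, \<alpha>) \<in> cohomologous \<Omega>"
      unfolding cohomologous_def by simp
  qed
  show "trans (cohomologous \<Omega>)"
  proof (rule transI)
    fix \<alpha> \<beta> \<gamma> assume "(\<alpha>, \<beta>) \<in> cohomologous \<Omega>" "(\<beta>, \<gamma>) \<in> cohomologous \<Omega>"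
    then obtain s t where co: "weak_cocycle \<Omega> \<alpha>" "weak_cocycle \<Omega> \<gamma>"
      and st: "continuous_map (pattern_topology \<Omega>) euclidean s"
        "continuous_map (pattern_topology \<Omega>) euclidean t"
        "\<forall>T\<in>\<Omega>. \<forall>v. \<beta> T v - \<alpha> T v = s (translate T v) - s T"
        "\<forall>T\<in>\<Omega>. \<forall>v. \<gamma> T v - \<beta> T v = t (translate T v) - t T"
      unfolding cohomologous_def weak_coboundary_def by blast
    have "continuous_map (pattern_topology \<Omega>) euclidean (\<lambda>T. s T + t T)"
      using st(1,2) by (rule continuous_map_add)
    moreover have "\<gamma> T v - \<alpha> T v = (s (translate T v) + t (translate T v)) - (s T + t T)"
      if "T \<in> \<Omega>" for T v
    proof -
      have "\<gamma> T v - \<alpha> T v = (\<beta> T v - \<alpha> T v) + (\<gamma> T v - \<beta> T v)"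
        by simp
      also have "\<dots> = (s (translate T v) - s T) + (t (translate T v) - t T)"
        using st(3)[rule_format, OF that, of v] st(4)[rule_format, OF that, of v] by (simp only:)
      finally show ?thesis
        by (simp add: algebra_simps)
    qed
    ultimately have "weak_coboundary \<Omega> (\<lambda>T v. \<gamma> T v - \<alpha> T v)"
      unfolding weak_coboundary_def by (intro exI[of _ "\<lambda>T. s T + t T"] conjI ballI allI)
    with co show "(\<alpha>, \<gamma>) \<in> cohomologous \<Omega>"
      unfolding cohomologous_def by simp
  qed
qed


definition orbit_equivalence ::
  "('n::finite, 'l::metric_space) pattern set \<Rightarrow> ('n, 'm::metric_space) pattern set \<Rightarrow>
     (('n, 'l) pattern \<Rightarrow> ('n, 'm) pattern) \<Rightarrow> bool" where
  "orbit_equivalence \<Omega> \<Omega>' h \<longleftrightarrow>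
     homeomorphic_map (pattern_topology \<Omega>) (pattern_topology \<Omega>') h \<and>
     (\<forall>T\<in>\<Omega>. h ` orbit T = orbit (h T))"

definition displacement ::
  "(('n::finite, 'l) pattern \<Rightarrow> ('n, 'm) pattern) \<Rightarrow> ('n, 'l) cochain" where
  "displacement h T x = (THE y. h (translate T x) = translate (h T) y)"

definition oe_class ::
  "('n::finite, 'l::metric_space) pattern set \<Rightarrow> (('n, 'l) pattern \<Rightarrow> ('n, 'm) pattern) \<Rightarrow>
     ('n, 'l) cochain set" where
  "oe_class \<Omega> h = cohomologous \<Omega> `` {displacement h}"

text \<open>
  The description below determines the map only for a nonempty class, on which the integral does
  not depend on the representative.
\<close>

definition ruelle_sullivan ::
  "('n::finite, 'l) pattern measure \<Rightarrow> ('n, 'l) cochain set \<Rightarrow> real^'n \<Rightarrow> real^'n" where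
  "ruelle_sullivan \<mu> c = (THE C. \<forall>\<alpha>\<in>c. C = (\<lambda>v. \<integral>T. \<alpha> T v \<partial>\<mu>))"

end

theory Submission
  imports Defs
begin

text \<open>
  Write \<open>\<alpha> T x\<close> for the displacement \<open>h\<^sub>T x\<close>, so that
  \<open>h (T - x) = h T - \<alpha> T x\<close>, and let \<open>\<rho> v = \<integral>T. \<alpha> T v \<partial>\<mu>\<close>.  The matrix is
  invertible because two growth statements contradict each other as soon as \<open>\<rho> v = 0\<close> for some
  \<open>v \<noteq> 0\<close>.

  On the one hand \<open>\<alpha>\<close> is a coarse bi-Lipschitz map in \<open>x\<close>.  A continuous cocycle over a compact
  space is bounded for \<open>x\<close> in the unit ball, hence by the cocycle identity
  \<open>norm (\<alpha> T x) \<le> K * (norm x + 1)\<close>.  The same estimate holds for the displacement of the inverse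
  homeomorphism, and that displacement undoes \<open>\<alpha> T\<close>; therefore
  \<open>norm x \<le> L * (norm (\<alpha> T x) + 1)\<close>, and \<open>\<alpha> T (n v)\<close> grows linearly in \<open>n\<close>.

  On the other hand, for a fixed \<open>v\<close> the vectors \<open>\<alpha> T (n v)\<close> are the Birkhoff sums of
  \<open>\<alpha> T v\<close> under translation by \<open>v\<close>.  Translation by \<open>v\<close> alone need not be ergodic, but moving \<open>T\<close> by
  any \<open>s\<close> changes \<open>\<alpha> T (n v)\<close> only by an amount bounded in \<open>n\<close>, again by the cocycle identity.
  Hence the set of those \<open>T\<close> for which a component of \<open>\<alpha> T (n v)\<close> exceeds \<open>n a\<close> by arbitrarily
  much is invariant under the whole action and has measure 0 or 1.  For \<open>a > 0\<close> and
  \<open>\<rho> v = 0\<close> the maximal ergodic inequality excludes measure 1.  So for almost every \<open>T\<close> the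
  sequence \<open>\<alpha> T (n v)\<close> grows more slowly than any prescribed linear rate
  (\<open>cocycle_upper_growth\<close>, \<open>mean_displacement_nonzero\<close>).

  The delicate point is the continuity of \<open>\<alpha>\<close>, since the topology that an orbit inherits from
  the tiling space is much coarser than that of \<open>\<real>\<^sup>d\<close>: a path inside an orbit could a priori
  jump between far away places that look alike.  The graph of \<open>\<alpha>\<close> is closed, so it is enough to
  bound \<open>\<alpha> T x\<close> for small \<open>x\<close>.  By compactness and aperiodicity \<open>norm (\<alpha> T x)\<close> avoids
  an interval \<open>[\<epsilon>, 1]\<close> for all small \<open>x\<close>; this splits a short segment into countably many closed
  classes, and by Sierpinski's theorem there is only one (\<open>displacement_small\<close>).

  All of this takes place for continuous actions of \<open>\<real>\<^sup>d\<close> on compact Hausdorff spaces.  The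
  pattern topology is Hausdorff and translation is continuous for it because closeness of
  patterns satisfies an approximate triangle inequality.
\<close>

section \<open>Continuous actions and the displacement of an orbit-preserving map\<close>

locale flow =
  fixes X :: "'a topology" and act :: "'a \<Rightarrow> 'v::euclidean_space \<Rightarrow> 'a"
  assumes compact: "compact_space X"
    and hausdorff: "Hausdorff_space X"
    and continuous_act: "continuous_map (prod_topology X euclidean) X (\<lambda>(T, x). act T x)"
    and act_zero: "T \<in> topspace X \<Longrightarrow> act T 0 = T"
    and act_act: "T \<in> topspace X \<Longrightarrow> act (act T x) y = act T (x + y)"
begin

lemma act_in_topspace: "T \<in> topspace X \<Longrightarrow> act T x \<in> topspace X"
  using continuous_map_image_subset_topspace[OF continuous_act] by force

lemma continuous_map_act:
  assumes "continuous_map Z X f" "continuous_map Z euclidean g"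
  shows "continuous_map Z X (\<lambda>z. act (f z) (g z))"
proof -
  have "continuous_map Z (prod_topology X euclidean) (\<lambda>z. (f z, g z))"
    using assms by (simp add: continuous_map_pairwise o_def)
  from continuous_map_compose[OF this continuous_act] show ?thesis
    by (simp add: o_def)
qed

end

locale free_flow = flow +
  assumes free: "T \<in> topspace X \<Longrightarrow> act T x = T \<Longrightarrow> x = 0"
begin

lemma act_inject:
  assumes "T \<in> topspace X" "act T x = act T y"
  shows "x = y"
proof -
  have "act (act T x) (y - x) = act T x"
    using assms act_act[OF assms(1), of x "y - x"] by simp
  then show ?thesis
    using free[of "act T x" "y - x"] assms act_in_topspace by simp
qed

end

locale orbit_map =
  source: flow X actX + target: free_flow Y actY
  for X :: "'a topology" and actX :: "'a \<Rightarrow> 'v::euclidean_space \<Rightarrow> 'a"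
    and Y :: "'b topology" and actY :: "'b \<Rightarrow> 'v \<Rightarrow> 'b" +
  fixes h :: "'a \<Rightarrow> 'b" and \<alpha> :: "'a \<Rightarrow> 'v \<Rightarrow> 'v"
  assumes continuous_h: "continuous_map X Y h"
    and intertwines: "T \<in> topspace X \<Longrightarrow> h (actX T x) = actY (h T) (\<alpha> T x)"
begin

lemma h_in_topspace: "T \<in> topspace X \<Longrightarrow> h T \<in> topspace Y"
  using continuous_map_image_subset_topspace[OF continuous_h] by blast

lemma displacement_eq_iff:
  "T \<in> topspace X \<Longrightarrow> actY (h T) y = h (actX T x) \<longleftrightarrow> y = \<alpha> T x"
  using intertwines[of T x] target.act_inject[OF h_in_topspace] by auto

lemma cocycle:
  assumes "T \<in> topspace X"
  shows "\<alpha> T (x + y) = \<alpha> T x + \<alpha> (actX T x) y"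
proof -
  have "actY (h T) (\<alpha> T x + \<alpha> (actX T x) y) = h (actX (actX T x) y)"
    using assms source.act_in_topspace[OF assms, of x]
    by (simp add: intertwines target.act_act h_in_topspace)
  also have "\<dots> = h (actX T (x + y))"
    using assms by (simp add: source.act_act)
  finally show ?thesis
    using assms by (simp add: displacement_eq_iff)
qed

lemma displacement_zero: "T \<in> topspace X \<Longrightarrow> \<alpha> T 0 = 0"
  using cocycle[of T 0 0] source.act_zero[of T] by simp

lemma displacement_diff:
  assumes "T \<in> topspace X"
  shows "\<alpha> T y - \<alpha> T x = \<alpha> (actX T x) (y - x)"
  using cocycle[OF assms, of x "y - x"] by simp

text \<open>
  A closed graph argument.  The graph of \<open>\<alpha>\<close> is closed since the actions and \<open>h\<close> are continuous,
  but projecting it to \<open>(T, x)\<close> preserves closedness only if the values run through a compact set.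
  The growth condition provides this uniformly in \<open>x\<close>: the values are
  \<open>(K * (norm x + 1)) *\<^sub>R u\<close> with \<open>u\<close> in the unit ball.
\<close>

lemma closedin_displacement:
  assumes "closed C" and "K > 0"
  shows "closedin (prod_topology X euclidean)
    {(T, x). T \<in> topspace X \<and> \<alpha> T x \<in> C \<and> norm (\<alpha> T x) \<le> K * (norm x + 1)}"
    (is "closedin _ ?S")
proof -
  let ?U = "cball (0::'v) 1"
  let ?Z = "prod_topology (prod_topology X euclidean) (top_of_set ?U)"
  let ?y = "\<lambda>z::('a \<times> 'v) \<times> 'v. (K * (norm (snd (fst z)) + 1)) *\<^sub>R snd z"
  let ?G = "{z \<in> topspace ?Z. actY (h (fst (fst z))) (?y z) = h (actX (fst (fst z)) (snd (fst z)))}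
    \<inter> {z \<in> topspace ?Z. ?y z \<in> C}"
  have 1: "continuous_map ?Z X (\<lambda>z. fst (fst z))"
    using continuous_map_compose[OF continuous_map_fst continuous_map_fst] by (simp add: o_def)
  have 2: "continuous_map ?Z euclidean (\<lambda>z. snd (fst z))"
    using continuous_map_compose[OF continuous_map_fst continuous_map_snd] by (simp add: o_def)
  have 3: "continuous_map ?Z euclidean snd"
    using continuous_map_snd continuous_map_into_fulltopology by blast
  have 4: "continuous_map ?Z euclidean ?y"
  proof -
    have a: "continuous_map ?Z euclidean (\<lambda>z. (snd (fst z), snd z))"
      using 2 3 by (simp add: continuous_map_pairwise o_def flip: prod_topology_euclidean)
    have b: "continuous_map euclidean euclidean (\<lambda>(x :: 'v, u). (K * (norm x + 1)) *\<^sub>R u :: 'v)"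
      by (auto simp: case_prod_unfold intro!: continuous_intros)
    show ?thesis
      using continuous_map_compose[OF a b] by (simp add: o_def)
  qed
  have "closedin ?Z ?G"
    by (intro closedin_Int closedin_continuous_maps_eq[OF target.hausdorff]
        closedin_continuous_map_preimage[OF 4] target.continuous_map_act 4 1 2
        continuous_map_compose[OF _ continuous_h, unfolded o_def] source.continuous_map_act)
      (use assms in auto)
  moreover have "closed_map ?Z (prod_topology X euclidean) fst"
    by (intro Abstract_Topological_Spaces.closed_map_fst) (simp add: compact_space_subtopology)
  ultimately have "closedin (prod_topology X euclidean) (fst ` ?G)"
    unfolding closed_map_def by blast
  also have "fst ` ?G = ?S"
  proof (intro subset_antisym subsetI)
    fix w assume "w \<in> fst ` ?G"
    then obtain T x u where w: "w = (T, x)" "T \<in> topspace X" "norm u \<le> 1"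
      "actY (h T) ((K * (norm x + 1)) *\<^sub>R u) = h (actX T x)" "(K * (norm x + 1)) *\<^sub>R u \<in> C"
      by force
    then have "\<alpha> T x = (K * (norm x + 1)) *\<^sub>R u"
      by (simp add: displacement_eq_iff)
    moreover have "norm ((K * (norm x + 1)) *\<^sub>R u) \<le> K * (norm x + 1)"
      using assms(2) w(3) by (simp add: mult_left_le abs_mult)
    ultimately show "w \<in> ?S"
      using w by auto
  next
    fix w assume "w \<in> ?S"
    then obtain T x where w: "w = (T, x)" "T \<in> topspace X" "\<alpha> T x \<in> C"
      "norm (\<alpha> T x) \<le> K * (norm x + 1)"
      by auto
    define r where "r = K * (norm x + 1)"
    have "r > 0"
      unfolding r_def using assms(2) by (simp add: add_nonneg_pos)
    then have "r *\<^sub>R ((1 / r) *\<^sub>R \<alpha> T x) = \<alpha> T x" "norm ((1 / r) *\<^sub>R \<alpha> T x) \<le> 1"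
      using w(4) by (simp_all flip: r_def)
    then obtain u where u: "(K * (norm x + 1)) *\<^sub>R u = \<alpha> T x" "norm u \<le> 1"
      unfolding r_def by blast
    have "((T, x), u) \<in> ?G"
      using w u intertwines[of T x] by simp
    then show "w \<in> fst ` ?G"
      using w(1) by force
  qed
  finally show ?thesis .
qed

text \<open>
  The vectors \<open>x\<close> with \<open>\<epsilon> \<le> norm (\<alpha> T x) \<le> 1\<close> for some \<open>T\<close> form a closed set, by projecting along
  the compact space, and this set misses \<open>0\<close> because \<open>\<alpha> T 0 = 0\<close>.
\<close>

lemma displacement_gap:
  assumes "0 < \<epsilon>"
  obtains \<delta> where "\<delta> > 0"
    "\<And>T x. T \<in> topspace X \<Longrightarrow> norm x < \<delta> \<Longrightarrow> norm (\<alpha> T x) \<le> 1 \<Longrightarrow> norm (\<alpha> T x) < \<epsilon>"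
proof -
  let ?C = "{y::'v. \<epsilon> \<le> norm y \<and> norm y \<le> 1}"
  let ?S = "{(T, x). T \<in> topspace X \<and> \<alpha> T x \<in> ?C \<and> norm (\<alpha> T x) \<le> 1 * (norm x + 1)}"
  have "closed ?C"
    by (intro closed_Collect_conj closed_Collect_le continuous_intros)
  then have "closedin (prod_topology X euclidean) ?S"
    by (rule closedin_displacement) simp
  then have "closed (snd ` ?S)"
    using Abstract_Topological_Spaces.closed_map_snd[OF source.compact, of "euclidean :: 'v topology"]
    by (simp add: closed_map_def)
  moreover have "0 \<notin> snd ` ?S"
    using displacement_zero assms by auto
  ultimately have "open (- snd ` ?S)" "0 \<in> - snd ` ?S"
    by (simp_all only: open_Compl Compl_iff not_False_eq_True)
  then obtain \<delta> where "\<delta> > 0" "ball 0 \<delta> \<subseteq> - snd ` ?S"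
    by (rule openE)
  moreover have "norm (\<alpha> T x) < \<epsilon>" if "T \<in> topspace X" "norm x < \<delta>" "norm (\<alpha> T x) \<le> 1" for T x
  proof (rule ccontr)
    assume "\<not> norm (\<alpha> T x) < \<epsilon>"
    then have "(T, x) \<in> ?S"
      using that norm_ge_zero[of x] by (simp add: add.commute add_increasing2 order_trans)
    then have "x \<in> snd ` ?S" by force
    then show False
      using \<open>ball 0 \<delta> \<subseteq> _\<close> that(2) by auto
  qed
  ultimately show ?thesis using that by blast
qed

text \<open>
  Along the segment from \<open>0\<close> to a short vector \<open>x\<close>, the increments of \<open>\<alpha> T\<close> have norm less than
  \<open>1/4\<close> or greater than \<open>1\<close>, by the gap.  Being within distance \<open>1\<close> is therefore an equivalence
  relation on the segment.  Its classes are closed, and countable in number since their values are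
  mutually separated.  A closed interval is not a countable disjoint union of several nonempty
  closed sets, so both endpoints of the segment lie in the same class.
\<close>

lemma displacement_small:
  obtains \<delta> where "\<delta> > 0"
    "\<And>T x. T \<in> topspace X \<Longrightarrow> norm x < \<delta> \<Longrightarrow> norm (\<alpha> T x) < 1/4"
proof -
  obtain \<delta> where \<delta>: "\<delta> > 0"
    "\<And>T x. T \<in> topspace X \<Longrightarrow> norm x < \<delta> \<Longrightarrow> norm (\<alpha> T x) \<le> 1 \<Longrightarrow> norm (\<alpha> T x) < 1/4"
    using displacement_gap[of "1/4"] by auto
  have "norm (\<alpha> T x) < 1/4" if T: "T \<in> topspace X" and x: "norm x < \<delta>" for T x
  proof -
    define c where "c t = \<alpha> T (t *\<^sub>R x)" for t :: real
    define E where "E t = {s \<in> {0..1}. norm (c s - c t) \<le> 1}" for t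
    have near: "norm (c s - c t) < 1/4"
      if "s \<in> {0..1}" "t \<in> {0..1}" "norm (c s - c t) \<le> 1" for s t
    proof -
      have eq: "c s - c t = \<alpha> (actX T (t *\<^sub>R x)) ((s - t) *\<^sub>R x)"
        unfolding c_def by (simp add: displacement_diff[OF T] scaleR_diff_left)
      have "norm ((s - t) *\<^sub>R x) \<le> norm x"
        using mult_right_mono[of "\<bar>s - t\<bar>" 1 "norm x"] that(1,2) by auto
      then show ?thesis
        using \<delta>(2)[OF source.act_in_topspace[OF T], of "(s - t) *\<^sub>R x" "t *\<^sub>R x"] x that(3)
        unfolding eq by linarith
    qed
    have closed_E: "closed (E t)" for t
    proof -
      let ?S = "{(T, x). T \<in> topspace X \<and> \<alpha> T x \<in> cball (c t) 1 \<and>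
        norm (\<alpha> T x) \<le> (norm (c t) + 1) * (norm x + 1)}"
      have cont: "continuous_map (top_of_set {0..1}) (prod_topology X euclidean) (\<lambda>s. (T, s *\<^sub>R x))"
        using T by (auto simp: continuous_map_pairwise o_def intro!: continuous_intros)
      have "closedin (top_of_set {0..1})
          {s \<in> topspace (top_of_set {0..1}). (T, s *\<^sub>R x) \<in> ?S}"
        by (rule closedin_continuous_map_preimage[OF cont closedin_displacement]) (auto simp: add_nonneg_pos)
      moreover have "{s \<in> topspace (top_of_set {0..1}). (T, s *\<^sub>R x) \<in> ?S} = E t"
      proof -
        have "norm (c s) \<le> (norm (c t) + 1) * (norm (s *\<^sub>R x) + 1)" if "norm (c s - c t) \<le> 1" for s
        proof -
          have "norm (c s) \<le> norm (c t) + 1"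
            using norm_triangle_sub[of "c s" "c t"] that by simp
          also have "\<dots> \<le> (norm (c t) + 1) * (norm (s *\<^sub>R x) + 1)"
            by (simp add: distrib_left del: norm_scaleR)
          finally show ?thesis .
        qed
        then show ?thesis
          unfolding E_def c_def using T by (auto simp: dist_norm norm_minus_commute)
      qed
      ultimately show ?thesis
        using closedin_closed_trans by fastforce
    qed
    obtain D :: "'v set" where D: "countable D" "\<And>U. open U \<Longrightarrow> U \<noteq> {} \<Longrightarrow> \<exists>d\<in>D. d \<in> U"
      using countable_dense_setE by blast
    \<comment> \<open>Each class is determined by any point of a countable dense set near one of its values.\<close>
    have "E t \<in> (\<lambda>q. {s \<in> {0..1}. norm (c s - q) \<le> 1/2}) ` D" if t: "t \<in> {0..1}" for t
    proof -
      obtain q where q: "q \<in> D" "norm (c t - q) < 1/4"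
        using D(2)[of "ball (c t) (1/4)"] by (auto simp: dist_norm)
      have "norm (c s - c t) \<le> 1 \<longleftrightarrow> norm (c s - q) \<le> 1/2" if "s \<in> {0..1}" for s
      proof
        assume "norm (c s - c t) \<le> 1"
        then have "norm (c s - c t) < 1/4" using near that t by blast
        then show "norm (c s - q) \<le> 1/2"
          using norm_triangle_ineq[of "c s - c t" "c t - q"] q(2) by simp
      next
        assume "norm (c s - q) \<le> 1/2"
        then show "norm (c s - c t) \<le> 1"
          using norm_triangle_ineq4[of "c s - q" "c t - q"] q(2) by simp
      qed
      then have "E t = {s \<in> {0..1}. norm (c s - q) \<le> 1/2}"
        unfolding E_def by blast
      then show ?thesis using q(1) by blast
    qed
    then have "countable (E ` {0..1})"
      using D(1) by (meson countable_image countable_subset image_subsetI)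
    moreover have "pairwise disjnt (E ` {0..1})"
    proof -
      have "E t = E t'" if t: "t \<in> {0..1}" "t' \<in> {0..1}" and s: "s \<in> E t" "s \<in> E t'" for s t t'
      proof -
        have s4: "norm (c s - c t) < 1/4" "norm (c s - c t') < 1/4" "s \<in> {0..1}"
          using s t near unfolding E_def by blast+
        then have tt: "norm (c t - c t') < 1/2"
          using norm_triangle_ineq4[of "c s - c t'" "c s - c t"] by simp
        have "norm (c r - c t) \<le> 1 \<longleftrightarrow> norm (c r - c t') \<le> 1" if r: "r \<in> {0..1}" for r
          using near[OF r t(1)] near[OF r t(2)] tt
            norm_triangle_ineq[of "c r - c t" "c t - c t'"]
            norm_triangle_ineq4[of "c r - c t'" "c t - c t'"] by fastforce
        then show ?thesis unfolding E_def by blast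
      qed
      then show ?thesis
        unfolding pairwise_def disjnt_def by blast
    qed
    moreover have "closed C \<and> C \<noteq> {}" if "C \<in> E ` {0..1}" for C
      using that closed_E unfolding E_def by fastforce
    moreover have "\<Union> (E ` {0..1}) = {0..1}"
      unfolding E_def by force
    ultimately have "E ` {0..1} = {{0..1}}"
      by (intro real_Sierpinski_lemma) auto
    then have "E 0 = {0..1}"
      by (metis atLeastAtMost_iff image_eqI order_refl singletonD zero_le_one)
    then have "1 \<in> E 0" by simp
    then have "norm (c 1 - c 0) < 1/4"
      using near[of 1 0] unfolding E_def by simp
    then show ?thesis
      unfolding c_def by (simp add: displacement_zero[OF T])
  qed
  then show ?thesis
    using that \<delta>(1) by blast
qed

lemma displacement_multiple:
  assumes "T \<in> topspace X"
  shows "\<alpha> T (real (Suc n) *\<^sub>R x) = \<alpha> T x + \<alpha> (actX T x) (real n *\<^sub>R x)"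
  using cocycle[OF assms, of x "real n *\<^sub>R x"] by (simp add: algebra_simps)

lemma displacement_linear_growth:
  obtains K where "K > 0" "\<And>T x. T \<in> topspace X \<Longrightarrow> norm (\<alpha> T x) \<le> K * (norm x + 1)"
proof -
  obtain \<delta> where \<delta>: "\<delta> > 0" "\<And>T x. T \<in> topspace X \<Longrightarrow> norm x < \<delta> \<Longrightarrow> norm (\<alpha> T x) < 1/4"
    using displacement_small by blast
  have mult: "norm (\<alpha> T (real n *\<^sub>R x)) \<le> real n" if "T \<in> topspace X" "norm x < \<delta>" for T x n
    using that
  proof (induction n arbitrary: T)
    case 0
    then show ?case by (simp add: displacement_zero)
  next
    case (Suc n)
    have "norm (\<alpha> T (real (Suc n) *\<^sub>R x)) \<le> norm (\<alpha> T x) + norm (\<alpha> (actX T x) (real n *\<^sub>R x))"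
      unfolding displacement_multiple[OF Suc.prems(1)] by (rule norm_triangle_ineq)
    also have "\<dots> \<le> 1 + real n"
      using \<delta>(2)[OF Suc.prems] Suc.IH[OF source.act_in_topspace[OF Suc.prems(1), of x] Suc.prems(2)]
      by linarith
    finally show ?case by simp
  qed
  show ?thesis
  proof (rule that[of "1/\<delta> + 1"])
    show "1/\<delta> + 1 > 0" using \<delta>(1) by (simp add: add_pos_pos)
    fix T and x :: 'v assume T: "T \<in> topspace X"
    define n where "n = Suc (nat \<lfloor>norm x / \<delta>\<rfloor>)"
    have n: "norm x / \<delta> < real n" "real n \<le> norm x / \<delta> + 1"
      unfolding n_def using \<delta>(1) by (auto simp: of_nat_nat) linarith
    have n_pos: "real n > 0" by (simp add: n_def)
    have "norm ((1 / real n) *\<^sub>R x) < \<delta>"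
    proof -
      have "norm x < real n * \<delta>"
        using n(1) \<delta>(1) by (simp add: pos_divide_less_eq)
      then show ?thesis
        using n_pos by (simp add: pos_divide_less_eq mult.commute)
    qed
    from mult[OF T this, of n] have "norm (\<alpha> T x) \<le> real n"
      by (simp add: n_def)
    also have "\<dots> \<le> (1/\<delta> + 1) * (norm x + 1)"
      using n(2) \<delta>(1) by (simp add: algebra_simps) (smt (verit) divide_nonneg_pos norm_ge_zero)
    finally show "norm (\<alpha> T x) \<le> (1/\<delta> + 1) * (norm x + 1)" .
  qed
qed

text \<open>
  By linear growth the size restriction in \<open>closedin_displacement\<close> holds everywhere, so preimages
  of closed sets are closed.
\<close>

lemma continuous_displacement:
  "continuous_map (prod_topology X euclidean) euclidean (\<lambda>(T, x). \<alpha> T x)"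
proof -
  obtain K where K: "K > 0" "\<And>T x. T \<in> topspace X \<Longrightarrow> norm (\<alpha> T x) \<le> K * (norm x + 1)"
    using displacement_linear_growth by blast
  show ?thesis
    unfolding continuous_map_closedin
  proof (intro conjI allI impI)
    fix C :: "'v set" assume "closedin euclidean C"
    then have "closed C" by simp
    then have "closedin (prod_topology X euclidean)
        {(T, x). T \<in> topspace X \<and> \<alpha> T x \<in> C \<and> norm (\<alpha> T x) \<le> K * (norm x + 1)}"
      using K(1) by (rule closedin_displacement)
    moreover have "{(T, x). T \<in> topspace X \<and> \<alpha> T x \<in> C \<and> norm (\<alpha> T x) \<le> K * (norm x + 1)} =
        {z \<in> topspace (prod_topology X (euclidean :: 'v topology)). (case z of (T, x) \<Rightarrow> \<alpha> T x) \<in> C}"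
      using K(2) by auto
    ultimately show "closedin (prod_topology X euclidean)
        {z \<in> topspace (prod_topology X (euclidean :: 'v topology)). (case z of (T, x) \<Rightarrow> \<alpha> T x) \<in> C}"
      by simp
  qed auto
qed

end

section \<open>The maximal ergodic inequality\<close>

text \<open>
  Garsia's argument.  Let \<open>m n\<close> be the maximum of \<open>S 0, \<dots>, S n\<close>.  Where \<open>m n > 0\<close>, this maximum is
  attained at a positive index, whence \<open>m n \<le> F + m n \<circ> \<tau>\<close>; elsewhere \<open>m n - m n \<circ> \<tau> \<le> 0\<close>.  As
  \<open>m n\<close> and \<open>m n \<circ> \<tau>\<close> have the same integral, the integral of \<open>F\<close> over \<open>{m n > 0}\<close> is nonnegative,
  and these sets increase to almost the whole space.
\<close>

lemma maximal_ergodic: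
  fixes F :: "'a \<Rightarrow> real"
  assumes \<tau>: "\<tau> \<in> measurable M M" "distr M M \<tau> = M"
    and F: "integrable M F"
    and S_0: "\<And>x. x \<in> space M \<Longrightarrow> S 0 x = 0"
    and S_Suc: "\<And>n x. x \<in> space M \<Longrightarrow> S (Suc n) x = F x + S n (\<tau> x)"
    and pos: "AE x in M. \<exists>n. S n x > 0"
  shows "0 \<le> (\<integral>x. F x \<partial>M)"
proof -
  \<comment> \<open>The recursion follows from \<open>S (Suc n) = F + S n \<circ> \<tau>\<close> and makes measurability and
    monotonicity immediate.\<close>
  define m where "m = rec_nat (\<lambda>_. 0) (\<lambda>n g x. max 0 (F x + g (\<tau> x)))"
  have m_0: "m 0 x = 0" and m_Suc: "m (Suc n) x = max 0 (F x + m n (\<tau> x))" for n x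
    unfolding m_def by simp_all
  have m_nonneg: "0 \<le> m n x" for n x
    by (cases n) (simp_all add: m_0 m_Suc)
  have m_mono: "m n x \<le> m (Suc n) x" for n x
  proof (induction n arbitrary: x)
    case (Suc n)
    show ?case
      using Suc.IH[of "\<tau> x"] unfolding m_Suc[of n] m_Suc[of "Suc n"] by linarith
  qed (simp add: m_0 m_nonneg)
  have S_le: "S n x \<le> m n x" if "x \<in> space M" for n x
    using that
  proof (induction n arbitrary: x)
    case (Suc n)
    then show ?case
      using measurable_space[OF \<tau>(1) Suc.prems] by (fastforce simp: S_Suc m_Suc)
  qed (simp add: S_0 m_0)
  have \<tau>_integrable: "integrable M (\<lambda>x. g (\<tau> x))" if "integrable M g" for g :: "'a \<Rightarrow> real"
    using integrable_distr[OF \<tau>(1), of g] \<tau>(2) that by simp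
  have \<tau>_integral: "(\<integral>x. g (\<tau> x) \<partial>M) = (\<integral>x. g x \<partial>M)" if "integrable M g" for g :: "'a \<Rightarrow> real"
    using integral_distr[OF \<tau>(1), of g] \<tau>(2) that by simp
  have m_integrable: "integrable M (m n)" for n
  proof (induction n)
    case 0
    have "m 0 = (\<lambda>_. 0)" by (rule ext) (rule m_0)
    then show ?case by simp
  next
    case (Suc n)
    have "m (Suc n) = (\<lambda>x. max 0 (F x + m n (\<tau> x)))" by (rule ext) (rule m_Suc)
    then show ?case
      using F Suc \<tau>_integrable by simp
  qed
  define P where "P n = {x \<in> space M. 0 < m n x}" for n
  have P_sets: "P n \<in> sets M" for n
    using borel_measurable_integrable[OF m_integrable[of n]] unfolding P_def by measurable
  have F_P: "integrable M (\<lambda>x. indicator (P n) x * F x)" for n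
    using integrable_mult_indicator[OF P_sets F] by simp
  have nonneg: "0 \<le> (\<integral>x. indicator (P n) x * F x \<partial>M)" for n
  proof -
    have "(\<integral>x. m n x - m n (\<tau> x) \<partial>M) = 0"
      using m_integrable \<tau>_integrable \<tau>_integral by simp
    moreover have "m n x - m n (\<tau> x) \<le> indicator (P n) x * F x" if "x \<in> space M" for x
    proof (cases "x \<in> P n")
      case True
      then obtain k where k: "n = Suc k"
        using m_0 by (cases n) (auto simp: P_def)
      then have "m n x = F x + m k (\<tau> x)"
        using True m_Suc[of k x] by (auto simp: P_def)
      then show ?thesis
        using True m_mono[of k "\<tau> x"] k by simp
    next
      case False
      then show ?thesis
        using that m_nonneg[of n x] m_nonneg[of n "\<tau> x"] by (simp add: P_def)
    qed
    ultimately show ?thesis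
      using integral_mono[of M "\<lambda>x. m n x - m n (\<tau> x)" "\<lambda>x. indicator (P n) x * F x"]
        m_integrable \<tau>_integrable F_P by simp
  qed
  have "(\<lambda>n. \<integral>x. indicator (P n) x * F x \<partial>M) \<longlonglongrightarrow> (\<integral>x. F x \<partial>M)"
  proof (rule integral_dominated_convergence[where w = "\<lambda>x. norm (F x)"])
    show "AE x in M. (\<lambda>n. indicator (P n) x * F x) \<longlonglongrightarrow> F x"
      using pos AE_space
    proof eventually_elim
      case (elim x)
      then obtain N where N: "S N x > 0" by blast
      have "indicator (P n) x * F x = F x" if "n \<ge> N" for n
        using N S_le[of x N] lift_Suc_mono_le[of "\<lambda>n. m n x", OF m_mono that] elim(2)
        by (simp add: P_def)
      then show ?case
        by (intro tendsto_eventually) (auto simp: eventually_sequentially)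
    qed
  qed (use F F_P in \<open>auto simp: indicator_def\<close>)
  then show ?thesis
    by (rule LIMSEQ_le_const) (use nonneg in blast)
qed

section \<open>Cocycles over a uniquely ergodic action\<close>

context flow
begin

definition invariant_probability :: "'a measure \<Rightarrow> bool" where
  "invariant_probability \<mu> \<longleftrightarrow>
     space \<mu> = topspace X \<and>
     sets \<mu> = sigma_sets (topspace X) {U. openin X U} \<and>
     emeasure \<mu> (topspace X) = 1 \<and>
     (\<forall>x. \<forall>A\<in>sets \<mu>. emeasure \<mu> ((\<lambda>T. act T x) ` A) = emeasure \<mu> A)"

lemma act_image_eq:
  assumes "A \<subseteq> topspace X"
  shows "(\<lambda>T. act T x) ` A = {T \<in> topspace X. act T (- x) \<in> A}"
proof (intro subset_antisym subsetI)
  fix T assume "T \<in> (\<lambda>T. act T x) ` A"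
  then show "T \<in> {T \<in> topspace X. act T (- x) \<in> A}"
    using assms act_in_topspace by (auto simp: act_act act_zero subset_iff)
next
  fix T assume "T \<in> {T \<in> topspace X. act T (- x) \<in> A}"
  then show "T \<in> (\<lambda>T. act T x) ` A"
    by (auto simp: act_act act_zero intro!: image_eqI[of T _ "act T (- x)"])
qed

end

locale uniquely_ergodic_flow = flow X act
  for X :: "'a topology" and act :: "'a \<Rightarrow> 'v::euclidean_space \<Rightarrow> 'a" +
  fixes \<mu> :: "'a measure"
  assumes invariant: "invariant_probability \<mu>"
    and unique: "invariant_probability \<nu> \<Longrightarrow> \<nu> = \<mu>"
begin

lemma space_\<mu>: "space \<mu> = topspace X"
  and sets_\<mu>: "sets \<mu> = sigma_sets (topspace X) {U. openin X U}"
  and total_\<mu>: "emeasure \<mu> (topspace X) = 1"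
  and emeasure_image: "A \<in> sets \<mu> \<Longrightarrow> emeasure \<mu> ((\<lambda>T. act T x) ` A) = emeasure \<mu> A"
  using invariant unfolding invariant_probability_def by auto

lemma finite_\<mu>: "finite_measure \<mu>"
  by (rule finite_measureI) (simp add: space_\<mu> total_\<mu>)

lemma continuous_map_measurable:
  fixes f :: "'a \<Rightarrow> 'b::topological_space"
  assumes "continuous_map X euclidean f"
  shows "f \<in> borel_measurable \<mu>"
proof (rule borel_measurableI)
  fix S :: "'b set" assume "open S"
  then have "openin X {T \<in> topspace X. f T \<in> S}"
    using openin_continuous_map_preimage[OF assms] by simp
  moreover have "f -` S \<inter> space \<mu> = {T \<in> topspace X. f T \<in> S}"
    by (auto simp: space_\<mu>)
  ultimately show "f -` S \<inter> space \<mu> \<in> sets \<mu>"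
    by (simp add: sets_\<mu> sigma_sets.Basic)
qed

lemma continuous_map_bounded:
  fixes f :: "'a \<Rightarrow> 'b::real_normed_vector"
  assumes "continuous_map X euclidean f"
  obtains B where "\<And>T. T \<in> topspace X \<Longrightarrow> norm (f T) \<le> B"
proof -
  have "compactin euclidean (f ` topspace X)"
    using image_compactin[OF _ assms] compact by (simp add: compact_space_def)
  then have "bounded (f ` topspace X)"
    by (simp add: compact_imp_bounded)
  then show ?thesis
    using that unfolding bounded_iff by blast
qed

lemma continuous_map_integrable:
  fixes f :: "'a \<Rightarrow> 'b::{banach, second_countable_topology}"
  assumes "continuous_map X euclidean f"
  shows "integrable \<mu> f"
proof -
  obtain B where "\<And>T. T \<in> topspace X \<Longrightarrow> norm (f T) \<le> B"
    using continuous_map_bounded[OF assms] by blast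
  then show ?thesis
    by (intro finite_measure.integrable_const_bound[OF finite_\<mu>, of f B]
        continuous_map_measurable[OF assms] AE_I2) (simp add: space_\<mu>)
qed

lemma act_measurable: "(\<lambda>T. act T x) \<in> measurable \<mu> \<mu>"
proof (rule measurable_sigma_sets[OF sets_\<mu>])
  have cont: "continuous_map X X (\<lambda>T. act T x)"
    by (intro continuous_map_act) auto
  fix U assume "U \<in> {U. openin X U}"
  then have "openin X {T \<in> topspace X. act T x \<in> U}"
    using openin_continuous_map_preimage[OF cont] by simp
  moreover have "(\<lambda>T. act T x) -` U \<inter> space \<mu> = {T \<in> topspace X. act T x \<in> U}"
    by (auto simp: space_\<mu>)
  ultimately show "(\<lambda>T. act T x) -` U \<inter> space \<mu> \<in> sets \<mu>"
    by (simp add: sets_\<mu> sigma_sets.Basic)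
qed (auto simp: space_\<mu> act_in_topspace dest: openin_subset)

lemma distr_act: "distr \<mu> \<mu> (\<lambda>T. act T x) = \<mu>"
proof (rule measure_eqI)
  fix A assume "A \<in> sets (distr \<mu> \<mu> (\<lambda>T. act T x))"
  then have A: "A \<in> sets \<mu>" by simp
  then have "A \<subseteq> topspace X" using sets.sets_into_space space_\<mu> by blast
  then have "(\<lambda>T. act T x) -` A \<inter> space \<mu> = (\<lambda>T. act T (- x)) ` A"
    by (auto simp: act_image_eq space_\<mu>)
  then show "emeasure (distr \<mu> \<mu> (\<lambda>T. act T x)) A = emeasure \<mu> A"
    using A by (simp add: emeasure_distr act_measurable emeasure_image)
qed simp

lemma integral_act:
  fixes f :: "'a \<Rightarrow> 'b::{banach, second_countable_topology}"
  assumes "f \<in> borel_measurable \<mu>"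
  shows "(\<integral>T. f (act T x) \<partial>\<mu>) = (\<integral>T. f T \<partial>\<mu>)"
  using integral_distr[OF act_measurable assms, of x] by (simp add: distr_act)

text \<open>
  Conditioning \<open>\<mu>\<close> on an invariant set of positive measure gives another invariant probability
  measure, which equals \<open>\<mu>\<close> by uniqueness.
\<close>

lemma ergodic:
  assumes A: "A \<in> sets \<mu>" and "emeasure \<mu> A \<noteq> 0"
    and inv: "\<And>T x. T \<in> topspace X \<Longrightarrow> T \<in> A \<Longrightarrow> act T x \<in> A"
  shows "AE T in \<mu>. T \<in> A"
proof -
  have fin: "emeasure \<mu> A \<noteq> \<infinity>"
    using finite_measure.emeasure_finite[OF finite_\<mu>] by simp
  have AX: "A \<subseteq> topspace X" using A sets.sets_into_space space_\<mu> by blast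
  let ?\<nu> = "uniform_measure \<mu> A"
  have "invariant_probability ?\<nu>"
    unfolding invariant_probability_def
  proof (intro conjI allI ballI)
    show "emeasure ?\<nu> (topspace X) = 1"
      using emeasure_uniform_measure_1[of \<mu> A] emeasure_uniform_measure[OF A sets.top] assms(2) fin
        A AX
      by (simp add: space_\<mu> Int_absorb2)
    fix x B assume "B \<in> sets ?\<nu>"
    then have B: "B \<in> sets \<mu>" by simp
    then have BX: "B \<subseteq> topspace X" using sets.sets_into_space space_\<mu> by blast
    have meas: "(\<lambda>T. act T x) ` C \<in> sets \<mu>" if "C \<in> sets \<mu>" for C
    proof -
      have "C \<subseteq> topspace X" using that sets.sets_into_space space_\<mu> by blast
      then have "(\<lambda>T. act T x) ` C = (\<lambda>T. act T (- x)) -` C \<inter> space \<mu>"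
        by (auto simp: act_image_eq space_\<mu>)
      then show ?thesis
        using measurable_sets[OF act_measurable that] by simp
    qed
    have "A \<inter> (\<lambda>T. act T x) ` B = (\<lambda>T. act T x) ` (A \<inter> B)"
    proof (intro subset_antisym subsetI)
      fix T assume T: "T \<in> A \<inter> (\<lambda>T. act T x) ` B"
      then obtain S where S: "S \<in> B" "T = act S x" by blast
      then have "act T (- x) = S" using BX by (auto simp: act_act act_zero)
      then have "S \<in> A" using inv[of T "- x"] T AX by auto
      then show "T \<in> (\<lambda>T. act T x) ` (A \<inter> B)" using S by blast
    qed (use inv AX in auto)
    then show "emeasure ?\<nu> ((\<lambda>T. act T x) ` B) = emeasure ?\<nu> B"
      using A B meas[OF B] emeasure_image[of "A \<inter> B" x] by simp
  qed (simp_all add: space_\<mu> sets_\<mu>)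
  then have "?\<nu> = \<mu>" by (rule unique)
  moreover have "emeasure ?\<nu> (space \<mu> - A) = 0"
    using A by simp
  ultimately have "emeasure \<mu> (space \<mu> - A) = 0" by simp
  then show ?thesis
    using A by (intro AE_I[of _ _ "space \<mu> - A"]) auto
qed

text \<open>
  The upper half of the pointwise ergodic theorem for \<open>n \<mapsto> \<phi> T (n v)\<close>, with a bounded error that is
  invisible after division by \<open>n\<close>.  The exceptional set is defined by an excess
  unbounded in \<open>n\<close>, so that it is exactly invariant: \<open>\<phi> (T - x) (n v)\<close> and \<open>\<phi> T (n v)\<close>
  differ by values of \<open>\<phi> _ x\<close>, which are bounded for fixed \<open>x\<close>.
\<close>

lemma cocycle_upper_growth:
  fixes \<phi> :: "'a \<Rightarrow> 'v \<Rightarrow> real"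
  assumes cont: "\<And>x. continuous_map X euclidean (\<lambda>T. \<phi> T x)"
    and cocycle: "\<And>T x y. T \<in> topspace X \<Longrightarrow> \<phi> T (x + y) = \<phi> T x + \<phi> (act T x) y"
    and less: "(\<integral>T. \<phi> T v \<partial>\<mu>) < a"
  shows "AE T in \<mu>. \<exists>K. \<forall>n. \<phi> T (real n *\<^sub>R v) \<le> real n * a + K"
proof -
  have [measurable]: "(\<lambda>T. \<phi> T x) \<in> borel_measurable \<mu>" for x
    by (intro continuous_map_measurable cont)
  define A where "A = {T \<in> space \<mu>. \<forall>k::nat. \<exists>n. \<phi> T (real n *\<^sub>R v) - real n * a > real k}"
  have A_sets: "A \<in> sets \<mu>"
    unfolding A_def by measurable
  have A_inv: "act T x \<in> A" if T: "T \<in> topspace X" "T \<in> A" for T x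
  proof -
    obtain B where B: "\<And>T. T \<in> topspace X \<Longrightarrow> norm (\<phi> T x) \<le> B"
      using continuous_map_bounded[OF cont] by blast
    have "\<exists>n. \<phi> (act T x) (real n *\<^sub>R v) - real n * a > real k" for k
    proof -
      obtain k' :: nat where k': "real k' \<ge> real k + 2 * B"
        using real_arch_simple by blast
      obtain n where n: "\<phi> T (real n *\<^sub>R v) - real n * a > real k'"
        using T(2) unfolding A_def by blast
      have "\<phi> T x + \<phi> (act T x) (real n *\<^sub>R v) = \<phi> T (real n *\<^sub>R v) + \<phi> (act T (real n *\<^sub>R v)) x"
        using cocycle[OF T(1), of x "real n *\<^sub>R v"] cocycle[OF T(1), of "real n *\<^sub>R v" x]
        by (simp add: add.commute)
      moreover have "\<bar>\<phi> T x\<bar> \<le> B" "\<bar>\<phi> (act T (real n *\<^sub>R v)) x\<bar> \<le> B"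
        using B[OF T(1)] B[OF act_in_topspace[OF T(1)]] by auto
      ultimately have "\<phi> (act T x) (real n *\<^sub>R v) - real n * a > real k"
        using n k' by linarith
      then show ?thesis by blast
    qed
    then show ?thesis
      unfolding A_def using act_in_topspace[OF T(1)] by (simp add: space_\<mu>)
  qed
  have "emeasure \<mu> A = 0"
  proof (rule ccontr)
    assume "emeasure \<mu> A \<noteq> 0"
    then have "AE T in \<mu>. T \<in> A"
      using ergodic[OF A_sets] A_inv by blast
    then have pos: "AE T in \<mu>. \<exists>n. \<phi> T (real n *\<^sub>R v) - real n * a > 0"
    proof eventually_elim
      case (elim T)
      then have "\<exists>n. \<phi> T (real n *\<^sub>R v) - real n * a > real 0"
        unfolding A_def by blast
      then show ?case by simp
    qed
    have int: "integrable \<mu> (\<lambda>T. \<phi> T v)"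
      by (intro continuous_map_integrable cont)
    have const: "integrable \<mu> (\<lambda>T. a)"
      by (intro continuous_map_integrable) simp
    have "0 \<le> (\<integral>T. \<phi> T v - a \<partial>\<mu>)"
    proof (rule maximal_ergodic[OF act_measurable distr_act _ _ _ pos])
      show "integrable \<mu> (\<lambda>T. \<phi> T v - a)"
        using int const by simp
      show "\<phi> T (real 0 *\<^sub>R v) - real 0 * a = 0" if "T \<in> space \<mu>" for T
        using cocycle[of T 0 0] act_zero[of T] that by (simp add: space_\<mu>)
      show "\<phi> T (real (Suc n) *\<^sub>R v) - real (Suc n) * a =
          \<phi> T v - a + (\<phi> (act T v) (real n *\<^sub>R v) - real n * a)" if "T \<in> space \<mu>" for T n
        using cocycle[of T v "real n *\<^sub>R v"] that by (simp add: space_\<mu> algebra_simps)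
    qed
    also have "\<dots> = (\<integral>T. \<phi> T v \<partial>\<mu>) - a"
      using int const by (simp add: measure_def total_\<mu> space_\<mu>)
    finally show False using less by simp
  qed
  then have "AE T in \<mu>. T \<notin> A"
    using A_sets by (simp add: AE_not_in null_setsI)
  then show ?thesis
  proof (rule AE_mp, intro AE_I2 impI)
    fix T assume "T \<in> space \<mu>" "T \<notin> A"
    then obtain k :: nat where "\<And>n. \<phi> T (real n *\<^sub>R v) - real n * a \<le> real k"
      unfolding A_def by (auto simp: not_less)
    then show "\<exists>K. \<forall>n. \<phi> T (real n *\<^sub>R v) \<le> real n * a + K"
      by (intro exI[of _ "real k"]) (simp add: diff_le_eq add.commute)
  qed
qed

end

context uniquely_ergodic_flow
begin

text \<open>
  The cocycle identity and invariance of the measure give additivity, and an additive map that is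
  bounded on bounded sets is linear: its deviation from homogeneity along \<open>x\<close> is additive and
  vanishes at the integers, so it is a bounded additive function on the line, hence zero.
\<close>

lemma linear_mean_displacement:
  fixes \<alpha> :: "'a \<Rightarrow> 'v \<Rightarrow> 'v"
  assumes cont: "\<And>x. continuous_map X euclidean (\<lambda>T. \<alpha> T x)"
    and cocycle: "\<And>T x y. T \<in> topspace X \<Longrightarrow> \<alpha> T (x + y) = \<alpha> T x + \<alpha> (act T x) y"
    and growth: "\<And>T x. T \<in> topspace X \<Longrightarrow> norm (\<alpha> T x) \<le> K * (norm x + 1)"
  shows "linear (\<lambda>v. \<integral>T. \<alpha> T v \<partial>\<mu>)" (is "linear ?\<rho>")
proof -
  have int: "integrable \<mu> (\<lambda>T. \<alpha> T x)" for x
    by (intro continuous_map_integrable cont)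
  have add: "?\<rho> (x + y) = ?\<rho> x + ?\<rho> y" for x y
  proof -
    have "?\<rho> (x + y) = (\<integral>T. \<alpha> T x + \<alpha> (act T x) y \<partial>\<mu>)"
      by (intro Bochner_Integration.integral_cong) (auto simp: space_\<mu> cocycle)
    also have "\<dots> = ?\<rho> x + (\<integral>T. \<alpha> (act T x) y \<partial>\<mu>)"
      using int integrable_distr[OF act_measurable, of x "\<lambda>T. \<alpha> T y"]
      by (intro Bochner_Integration.integral_add) (auto simp: distr_act)
    also have "(\<integral>T. \<alpha> (act T x) y \<partial>\<mu>) = ?\<rho> y"
      using int by (intro integral_act[of "\<lambda>T. \<alpha> T y"]) auto
    finally show ?thesis .
  qed
  have bound: "norm (?\<rho> x) \<le> K * (norm x + 1)" for x
  proof -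
    have "norm (?\<rho> x) \<le> (\<integral>T. norm (\<alpha> T x) \<partial>\<mu>)"
      by (rule integral_norm_bound)
    also have "\<dots> \<le> (\<integral>T. K * (norm x + 1) \<partial>\<mu>)"
      using growth
      by (intro integral_mono continuous_map_integrable continuous_map_norm cont) (auto simp: space_\<mu>)
    finally show ?thesis
      by (simp add: measure_def total_\<mu> space_\<mu>)
  qed
  have zero: "?\<rho> 0 = 0" using add[of 0 0] by simp
  have minus: "?\<rho> (- x) = - ?\<rho> x" for x
    using add[of x "- x"] zero by (simp add: eq_neg_iff_add_eq_0 add.commute)
  have mult: "?\<rho> (real n *\<^sub>R x) = real n *\<^sub>R ?\<rho> x" for n x
    by (induction n) (simp_all add: zero add scaleR_add_left)
  have mult_int: "?\<rho> (of_int n *\<^sub>R x) = of_int n *\<^sub>R ?\<rho> x" for n x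
  proof (cases "n \<ge> 0")
    case True
    then show ?thesis using mult[of "nat n" x] by simp
  next
    case False
    then show ?thesis using mult[of "nat (- n)" x] minus[of "of_int n *\<^sub>R x"] by simp
  qed
  have scale: "?\<rho> (c *\<^sub>R x) = c *\<^sub>R ?\<rho> x" for c x
  proof -
    define g where "g c = ?\<rho> (c *\<^sub>R x) - c *\<^sub>R ?\<rho> x" for c
    define B where "B = K * (norm x + 1) + norm (?\<rho> x)"
    have K: "K \<ge> 0" using order_trans[OF norm_ge_zero bound[of 0]] by simp
    have g_bound: "norm (g c) \<le> B" for c
    proof -
      have "g c = ?\<rho> (frac c *\<^sub>R x + of_int \<lfloor>c\<rfloor> *\<^sub>R x) - (frac c + of_int \<lfloor>c\<rfloor>) *\<^sub>R ?\<rho> x"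
        unfolding g_def frac_def by (simp flip: scaleR_add_left)
      also have "\<dots> = ?\<rho> (frac c *\<^sub>R x) - frac c *\<^sub>R ?\<rho> x"
        unfolding add mult_int by (simp add: scaleR_add_left)
      finally have "norm (g c) \<le> norm (?\<rho> (frac c *\<^sub>R x)) + frac c * norm (?\<rho> x)"
        using norm_triangle_ineq4[of "?\<rho> (frac c *\<^sub>R x)" "frac c *\<^sub>R ?\<rho> x"] by simp
      also have "\<dots> \<le> K * (frac c * norm x + 1) + frac c * norm (?\<rho> x)"
        using bound[of "frac c *\<^sub>R x"] by simp
      also have "\<dots> \<le> K * (1 * norm x + 1) + 1 * norm (?\<rho> x)"
        using K frac_lt_1[of c] by (intro add_mono mult_left_mono mult_right_mono) auto
      finally show ?thesis by (simp add: B_def)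
    qed
    have "g c = 0"
    proof (rule ccontr)
      assume "g c \<noteq> 0"
      then obtain n where n: "real n * norm (g c) > B"
        using reals_Archimedean3[of "norm (g c)"] by (metis zero_less_norm_iff)
      have "g (real n * c) = real n *\<^sub>R g c"
        unfolding g_def using mult[of n "c *\<^sub>R x"] by (simp add: scaleR_diff_right)
      then show False
        using g_bound[of "real n * c"] n by simp
    qed
    then show ?thesis by (simp add: g_def)
  qed
  show ?thesis
    using add scale by (rule linearI)
qed

text \<open>
  If the mean vanished, all components of \<open>\<alpha> T (n v)\<close> would be bounded by \<open>n * a\<close> up to a constant,
  for a common \<open>T\<close> and any given \<open>a > 0\<close>.  For small \<open>a\<close> this contradicts the linear lower bound
  that \<open>expansion\<close> gives for \<open>norm (\<alpha> T (n v))\<close>.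
\<close>

lemma mean_displacement_nonzero:
  fixes \<alpha> :: "'a \<Rightarrow> 'v \<Rightarrow> 'v"
  assumes cont: "\<And>x. continuous_map X euclidean (\<lambda>T. \<alpha> T x)"
    and cocycle: "\<And>T x y. T \<in> topspace X \<Longrightarrow> \<alpha> T (x + y) = \<alpha> T x + \<alpha> (act T x) y"
    and expansion: "\<And>T x. T \<in> topspace X \<Longrightarrow> norm x \<le> K * (norm (\<alpha> T x) + 1)"
    and "v \<noteq> 0"
  shows "(\<integral>T. \<alpha> T v \<partial>\<mu>) \<noteq> 0"
proof
  assume zero: "(\<integral>T. \<alpha> T v \<partial>\<mu>) = 0"
  have int: "integrable \<mu> (\<lambda>T. \<alpha> T v)"
    by (intro continuous_map_integrable cont)
  define D where "D = real DIM('v)"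
  have D: "D \<ge> 1" unfolding D_def using DIM_positive[where 'a = 'v] by linarith
  \<comment> \<open>With this choice the upper bound on \<open>norm (n v)\<close> has slope \<open>norm v / 2\<close> in \<open>n\<close>.\<close>
  define a where "a = norm v / 2 / ((\<bar>K\<bar> + 1) * D)"
  have a: "a > 0" using D \<open>v \<noteq> 0\<close> by (simp add: a_def)
  \<comment> \<open>Both signs of the basis vectors turn one-sided bounds into bounds on absolute values.\<close>
  define B where "B = (Basis :: 'v set) \<union> uminus ` Basis"
  have upper: "AE T in \<mu>. \<exists>C. \<forall>n. \<alpha> T (real n *\<^sub>R v) \<bullet> u \<le> real n * a + C" for u
  proof (rule cocycle_upper_growth[of "\<lambda>T x. \<alpha> T x \<bullet> u" v a])
    show "continuous_map X euclidean (\<lambda>T. \<alpha> T x \<bullet> u)" for x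
    proof -
      have "continuous_map euclidean euclidean (\<lambda>y. y \<bullet> u)"
        by (simp add: continuous_intros)
      from continuous_map_compose[OF cont this] show ?thesis by (simp add: o_def)
    qed
    show "\<alpha> T (x + y) \<bullet> u = \<alpha> T x \<bullet> u + \<alpha> (act T x) y \<bullet> u" if "T \<in> topspace X" for T x y
      by (simp add: cocycle[OF that] inner_add_left)
    show "(\<integral>T. \<alpha> T v \<bullet> u \<partial>\<mu>) < a"
      using int zero a by simp
  qed
  have "AE T in \<mu>. \<forall>u\<in>B. \<exists>C. \<forall>n. \<alpha> T (real n *\<^sub>R v) \<bullet> u \<le> real n * a + C"
    using upper by (intro AE_finite_allI) (auto simp: B_def)
  with AE_space have "AE T in \<mu>. T \<in> topspace X \<and>
      (\<forall>u\<in>B. \<exists>C. \<forall>n. \<alpha> T (real n *\<^sub>R v) \<bullet> u \<le> real n * a + C)"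
    by eventually_elim (simp add: space_\<mu>)
  moreover have "ae_filter \<mu> \<noteq> bot"
    by (simp add: ae_filter_eq_bot_iff space_\<mu> total_\<mu>)
  ultimately obtain T where T: "T \<in> topspace X"
    and "\<forall>u\<in>B. \<exists>C. \<forall>n. \<alpha> T (real n *\<^sub>R v) \<bullet> u \<le> real n * a + C"
    using eventually_happens' by blast
  then obtain C where C: "\<And>u n. u \<in> B \<Longrightarrow> \<alpha> T (real n *\<^sub>R v) \<bullet> u \<le> real n * a + C u"
    by metis
  define C' where "C' = (\<Sum>b\<in>Basis. max (C b) (C (- b)))"
  have upper_norm: "norm (\<alpha> T (real n *\<^sub>R v)) \<le> D * (real n * a) + C'" for n
  proof -
    have "norm (\<alpha> T (real n *\<^sub>R v)) \<le> (\<Sum>b\<in>Basis. \<bar>\<alpha> T (real n *\<^sub>R v) \<bullet> b\<bar>)"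
      by (rule norm_le_l1)
    also have "\<dots> \<le> (\<Sum>b\<in>Basis. real n * a + max (C b) (C (- b)))"
    proof (rule sum_mono)
      fix b :: 'v assume "b \<in> Basis"
      then show "\<bar>\<alpha> T (real n *\<^sub>R v) \<bullet> b\<bar> \<le> real n * a + max (C b) (C (- b))"
        using C[of b n] C[of "- b" n] by (auto simp: B_def)
    qed
    also have "\<dots> = D * (real n * a) + C'"
      by (simp add: sum.distrib C'_def D_def)
    finally show ?thesis .
  qed
  define E where "E = (\<bar>K\<bar> + 1) * (\<bar>C'\<bar> + 1)"
  have "real n * norm v \<le> 2 * E" for n
  proof -
    have "real n * norm v \<le> K * (norm (\<alpha> T (real n *\<^sub>R v)) + 1)"
      using expansion[OF T, of "real n *\<^sub>R v"] by simp
    also have "\<dots> \<le> (\<bar>K\<bar> + 1) * (D * (real n * a) + \<bar>C'\<bar> + 1)"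
      using upper_norm[of n] by (intro mult_mono) auto
    also have "\<dots> = (\<bar>K\<bar> + 1) * D * a * real n + E"
      by (simp add: E_def algebra_simps)
    also have "(\<bar>K\<bar> + 1) * D * a = norm v / 2"
      using D by (simp add: a_def)
    finally show ?thesis by (simp add: algebra_simps)
  qed
  moreover obtain n where "real n * norm v > 2 * E"
    using reals_Archimedean3[of "norm v"] \<open>v \<noteq> 0\<close> by (metis zero_less_norm_iff)
  ultimately show False using not_le by blast
qed

end

section \<open>Closeness of patterns\<close>

lemma hausdorff_dist_commute: "hausdorff_dist A B = hausdorff_dist B A"
  by (simp add: hausdorff_dist_def max.commute)

lemma hausdorff_dist_le_iff:
  fixes A B :: "'a::metric_space set"
  assumes "bounded A" "A \<noteq> {}" "bounded B" "B \<noteq> {}"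
  shows "hausdorff_dist A B \<le> r \<longleftrightarrow> (\<forall>a\<in>A. infdist a B \<le> r) \<and> (\<forall>b\<in>B. infdist b A \<le> r)"
proof -
  have bdd: "bdd_above ((\<lambda>a. infdist a D) ` C)" if C: "bounded C" and D: "D \<noteq> {}"
    for C D :: "'a set"
  proof -
    obtain d where d: "d \<in> D" using D by blast
    obtain e where "\<forall>c\<in>C. dist d c \<le> e" using C bounded_any_center by blast
    then have "infdist c D \<le> e" if c: "c \<in> C" for c
      using infdist_le[OF d, of c] c by (force simp: dist_commute)
    then show ?thesis by (auto intro!: bdd_aboveI)
  qed
  show ?thesis
    unfolding hausdorff_dist_def using assms bdd by (simp add: cSUP_le_iff)
qed

lemma hausdorff_dist_triangle:
  fixes A B C :: "'a::metric_space set"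
  assumes "bounded A" "A \<noteq> {}" "bounded B" "B \<noteq> {}" "bounded C" "C \<noteq> {}"
  shows "hausdorff_dist A C \<le> hausdorff_dist A B + hausdorff_dist B C"
proof -
  have *: "infdist a E \<le> r + s"
    if "infdist a D \<le> r" "D \<noteq> {}" "\<And>d. d \<in> D \<Longrightarrow> infdist d E \<le> s" for a :: 'a and D E r s
  proof -
    have "infdist a E - s \<le> dist a d" if "d \<in> D" for d
      using infdist_triangle[of a E d] \<open>\<And>d. d \<in> D \<Longrightarrow> infdist d E \<le> s\<close>[OF that] by simp
    then have "infdist a E - s \<le> infdist a D"
      using that(2) by (auto simp: infdist_notempty intro: cINF_greatest)
    then show ?thesis using that(1) by simp
  qed
  have AB: "infdist a B \<le> hausdorff_dist A B" if "a \<in> A" for a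
    using hausdorff_dist_le_iff[of A B "hausdorff_dist A B"] assms that by auto
  have BA: "infdist b A \<le> hausdorff_dist A B" if "b \<in> B" for b
    using hausdorff_dist_le_iff[of A B "hausdorff_dist A B"] assms that by auto
  have BC: "infdist b C \<le> hausdorff_dist B C" if "b \<in> B" for b
    using hausdorff_dist_le_iff[of B C "hausdorff_dist B C"] assms that by auto
  have CB: "infdist c B \<le> hausdorff_dist B C" if "c \<in> C" for c
    using hausdorff_dist_le_iff[of B C "hausdorff_dist B C"] assms that by auto
  have "infdist a C \<le> hausdorff_dist A B + hausdorff_dist B C" if "a \<in> A" for a
    using *[OF AB[OF that] assms(4) BC] .
  moreover have "infdist c A \<le> hausdorff_dist A B + hausdorff_dist B C" if "c \<in> C" for c
    using *[OF CB[OF that] assms(4) BA] by (simp add: add.commute)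
  ultimately show ?thesis
    using assms hausdorff_dist_le_iff by blast
qed

text \<open>
  Tiles and singletons are nonempty and compact, and on such sets the Hausdorff distance is a metric.
\<close>

definition compact_pieces :: "('n::finite, 'l) pattern \<Rightarrow> bool" where
  "compact_pieces T \<longleftrightarrow> (\<forall>p\<in>T. compact (fst p) \<and> fst p \<noteq> {})"

lemma piece_dist_commute: "piece_dist p q = piece_dist q p"
  by (simp add: piece_dist_def hausdorff_dist_commute dist_commute)

lemma piece_dist_triangle:
  assumes "compact (fst p)" "fst p \<noteq> {}" "compact (fst q)" "fst q \<noteq> {}" "compact (fst r)" "fst r \<noteq> {}"
  shows "piece_dist p r \<le> piece_dist p q + piece_dist q r"
  using hausdorff_dist_triangle[of "fst p" "fst q" "fst r"] dist_triangle[of "snd p" "snd r" "snd q"] assms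
  unfolding piece_dist_def by (auto dest!: compact_imp_bounded)

lemma piece_dist_infdist:
  assumes "compact (fst p)" "fst p \<noteq> {}" "compact (fst q)" "fst q \<noteq> {}" "a \<in> fst p"
  shows "infdist a (fst q) \<le> piece_dist p q"
  using hausdorff_dist_le_iff[of "fst p" "fst q" "piece_dist p q"] assms
  by (auto simp: piece_dist_def compact_imp_bounded)

lemma piece_dist_refl_le: "compact (fst p) \<Longrightarrow> fst p \<noteq> {} \<Longrightarrow> piece_dist p p \<le> 0"
  using hausdorff_dist_le_iff[of "fst p" "fst p" 0] by (auto simp: piece_dist_def compact_imp_bounded)

lemma piece_dist_le_0_imp_eq:
  assumes "compact (fst p)" "fst p \<noteq> {}" "compact (fst q)" "fst q \<noteq> {}" "piece_dist p q \<le> 0"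
  shows "p = q"
proof -
  have sub: "fst r \<subseteq> fst s" if "compact (fst r)" "fst r \<noteq> {}" "compact (fst s)" "fst s \<noteq> {}" "piece_dist r s \<le> 0"
    for r s :: "('a, 'b) piece"
  proof
    fix a assume "a \<in> fst r"
    then have "infdist a (fst s) \<le> 0"
      using piece_dist_infdist[of r s a] that by simp
    then have "infdist a (fst s) = 0"
      using infdist_nonneg order_antisym by blast
    then show "a \<in> fst s"
      using in_closed_iff_infdist_zero[of "fst s" a] that by (simp add: compact_imp_closed)
  qed
  have "fst p = fst q"
    using sub[of p q] sub[of q p] assms by (simp add: piece_dist_commute)
  moreover have "snd p = snd q"
    using assms(5) by (simp add: piece_dist_def)
  ultimately show ?thesis by (simp add: prod_eq_iff)
qed

lemma piece_dist_meets_cball: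
  assumes "compact (fst p)" "fst p \<noteq> {}" "compact (fst q)" "fst q \<noteq> {}" "piece_dist p q < \<epsilon>"
    and "fst p \<inter> cball 0 r \<noteq> {}" "r + \<epsilon> \<le> r'"
  shows "fst q \<inter> cball 0 r' \<noteq> {}"
proof -
  obtain a where a: "a \<in> fst p" "norm a \<le> r" using assms(6) by auto
  obtain b where b: "b \<in> fst q" "infdist a (fst q) = dist a b"
    using infdist_attains_inf[of "fst q" a] assms(3,4) compact_imp_closed by blast
  then have "dist a b < \<epsilon>"
    using piece_dist_infdist[of p q a] assms a by simp
  then have "norm b \<le> r'"
    using a(2) assms(7) norm_triangle_sub[of b a] by (simp add: dist_norm norm_minus_commute)
  then show ?thesis using b(1) by auto
qed

lemma piece_dist_shift: "piece_dist (shift x p) (shift x q) = piece_dist p q"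
proof -
  have "infdist (a - x) ((\<lambda>y. y - x) ` B) = infdist a B" for a and B :: "(real^'a) set"
    by (simp add: infdist_def image_image dist_norm)
  then show ?thesis
    by (simp add: piece_dist_def hausdorff_dist_def shift_def image_image)
qed

lemma piece_dist_shift_self:
  assumes "compact (fst p)" "fst p \<noteq> {}"
  shows "piece_dist p (shift x p) \<le> norm x"
proof -
  have 1: "infdist a ((\<lambda>y. y - x) ` fst p) \<le> norm x" if "a \<in> fst p" for a
    using infdist_le[of "a - x" "(\<lambda>y. y - x) ` fst p" a] that by (simp add: dist_norm)
  have 2: "infdist (a - x) (fst p) \<le> norm x" if "a \<in> fst p" for a
    using infdist_le[of a "fst p" "a - x"] that by (simp add: dist_norm)
  have "bounded ((\<lambda>y. y - x) ` fst p)"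
    using assms(1) by (simp add: bounded_translation_minus compact_imp_bounded)
  then show ?thesis
    using hausdorff_dist_le_iff[of "fst p" "(\<lambda>y. y - x) ` fst p" "norm x"] 1 2 assms
    by (simp add: piece_dist_def shift_def compact_imp_bounded)
qed

lemma shift_shift [simp]: "shift y (shift x p) = shift (x + y) p"
  by (simp add: shift_def image_image diff_diff_eq)

lemma shift_0 [simp]: "shift 0 p = p"
  by (simp add: shift_def)

lemma inj_shift: "inj_on (shift x) A"
  by (rule inj_on_inverseI[of _ "shift (- x)"]) simp

lemma translate_0: "translate T 0 = T"
  by (simp add: translate_def)

lemma translate_translate: "translate (translate T x) y = translate T (x + y)"
  by (simp add: translate_def image_image)

lemma close_refl:
  assumes "compact_pieces T" "\<epsilon> > 0"
  shows "close \<epsilon> T T"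
  unfolding close_def
proof (intro exI conjI ballI impI)
  show "bij_betw (\<lambda>p. p) T T" by (simp add: bij_betw_def)
  show "piece_dist p p < \<epsilon>" if "p \<in> T" for p
    using piece_dist_refl_le[of p] assms that by (auto simp: compact_pieces_def)
qed auto

lemma close_sym:
  assumes "close \<epsilon> S T"
  shows "close \<epsilon> T S"
proof -
  obtain A B f where *: "A \<subseteq> S" "B \<subseteq> T" "bij_betw f A B"
    "\<forall>p\<in>S. fst p \<inter> cball 0 (1/\<epsilon>) \<noteq> {} \<longrightarrow> p \<in> A"
    "\<forall>q\<in>T. fst q \<inter> cball 0 (1/\<epsilon>) \<noteq> {} \<longrightarrow> q \<in> B"
    "\<forall>p\<in>A. piece_dist p (f p) < \<epsilon>"
    using assms unfolding close_def by blast
  have "piece_dist q (inv_into A f q) < \<epsilon>" if "q \<in> B" for q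
    using *(3,6) that by (metis bij_betw_imp_surj_on f_inv_into_f inv_into_into piece_dist_commute)
  then show ?thesis
    unfolding close_def using *(1,2,4,5) bij_betw_inv_into[OF *(3)]
    by (intro exI[of _ B] exI[of _ A] exI[of _ "inv_into A f"] conjI ballI impI) simp_all
qed

text \<open>
  The two partial matchings are composed where possible.  A piece that meets the ball of the smaller
  radius \<open>1 / (2 * \<epsilon>)\<close> is moved by less than \<open>\<epsilon>\<close>, so its partner meets the ball of radius \<open>1/\<epsilon>\<close>
  and is matched again; \<open>\<epsilon> \<le> 1/2\<close> leaves room for this.
\<close>

lemma close_trans:
  assumes pieces: "compact_pieces S" "compact_pieces T" "compact_pieces R"
    and "close \<epsilon> S T" "close \<epsilon> T R" and \<epsilon>: "0 < \<epsilon>" "\<epsilon> \<le> 1/2"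
  shows "close (2 * \<epsilon>) S R"
proof -
  obtain A B f where f: "A \<subseteq> S" "B \<subseteq> T" "bij_betw f A B"
    "\<And>p. p \<in> S \<Longrightarrow> fst p \<inter> cball 0 (1/\<epsilon>) \<noteq> {} \<Longrightarrow> p \<in> A"
    "\<And>q. q \<in> T \<Longrightarrow> fst q \<inter> cball 0 (1/\<epsilon>) \<noteq> {} \<Longrightarrow> q \<in> B"
    "\<And>p. p \<in> A \<Longrightarrow> piece_dist p (f p) < \<epsilon>"
    using assms(4) unfolding close_def by blast
  obtain B' C g where g: "B' \<subseteq> T" "C \<subseteq> R" "bij_betw g B' C"
    "\<And>q. q \<in> T \<Longrightarrow> fst q \<inter> cball 0 (1/\<epsilon>) \<noteq> {} \<Longrightarrow> q \<in> B'"
    "\<And>r. r \<in> R \<Longrightarrow> fst r \<inter> cball 0 (1/\<epsilon>) \<noteq> {} \<Longrightarrow> r \<in> C"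
    "\<And>q. q \<in> B' \<Longrightarrow> piece_dist q (g q) < \<epsilon>"
    using assms(5) unfolding close_def by blast
  have "2 * (\<epsilon> * \<epsilon>) \<le> 1"
    using mult_mono[of \<epsilon> "1/2" \<epsilon> "1/2"] \<epsilon> by simp
  then have radius: "1 / (2 * \<epsilon>) + \<epsilon> \<le> 1 / \<epsilon>"
    using \<epsilon>(1) by (simp add: field_simps)
  have sub: "s \<inter> cball 0 (1 / \<epsilon>) \<noteq> {}" if "s \<inter> cball 0 (1 / (2 * \<epsilon>)) \<noteq> {}" for s :: "(real^'a) set"
    using that subset_cball[of "1 / (2 * \<epsilon>)" "1 / \<epsilon>" "0 :: real^'a"] radius \<epsilon>(1) by fastforce
  have f_in: "f p \<in> B" if "p \<in> A" for p
    using f(3) that bij_betwE by blast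
  have g_in: "g q \<in> C" if "q \<in> B'" for q
    using g(3) that bij_betwE by blast
  let ?A = "{p \<in> A. f p \<in> B'}" and ?h = "\<lambda>p. g (f p)"
  show ?thesis
    unfolding close_def
  proof (intro exI conjI ballI impI)
    show "?A \<subseteq> S" using f(1) by blast
    show "?h ` ?A \<subseteq> R" using g(2) g_in by blast
    show "bij_betw ?h ?A (?h ` ?A)"
      using bij_betw_imp_inj_on[OF f(3)] bij_betw_imp_inj_on[OF g(3)]
      unfolding bij_betw_def inj_on_def by blast
  next
    fix p assume p: "p \<in> S" "fst p \<inter> cball 0 (1 / (2 * \<epsilon>)) \<noteq> {}"
    then have pA: "p \<in> A" using f(4) sub by blast
    then have "f p \<in> T" using f_in f(2) by blast
    moreover have "fst (f p) \<inter> cball 0 (1 / \<epsilon>) \<noteq> {}"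
      using piece_dist_meets_cball[OF _ _ _ _ f(6)[OF pA] p(2) radius] pieces p(1) \<open>f p \<in> T\<close>
      by (auto simp: compact_pieces_def)
    ultimately show "p \<in> ?A" using pA g(4) by blast
  next
    fix r assume r: "r \<in> R" "fst r \<inter> cball 0 (1 / (2 * \<epsilon>)) \<noteq> {}"
    then have "r \<in> C" using g(5) sub by blast
    then obtain q where q: "q \<in> B'" "r = g q"
      using g(3) by (metis bij_betw_imp_surj_on imageE)
    then have "q \<in> T" using g(1) by blast
    have "piece_dist r q < \<epsilon>" using g(6)[OF q(1)] q(2) by (simp add: piece_dist_commute)
    then have "fst q \<inter> cball 0 (1 / \<epsilon>) \<noteq> {}"
      using piece_dist_meets_cball[OF _ _ _ _ _ r(2) radius, of q] pieces r(1) \<open>q \<in> T\<close>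
      by (auto simp: compact_pieces_def)
    then have "q \<in> B" using f(5) \<open>q \<in> T\<close> by blast
    then obtain p where "p \<in> A" "q = f p"
      using f(3) by (metis bij_betw_imp_surj_on imageE)
    then show "r \<in> ?h ` ?A" using q by blast
  next
    fix p assume p: "p \<in> ?A"
    then have in_sets: "p \<in> S" "f p \<in> T" "g (f p) \<in> R"
      using f(1) g(1,2) g_in by blast+
    have "piece_dist p (f p) < \<epsilon>" "piece_dist (f p) (g (f p)) < \<epsilon>"
      using f(6) g(6) p by blast+
    moreover have "piece_dist p (g (f p)) \<le> piece_dist p (f p) + piece_dist (f p) (g (f p))"
      using in_sets pieces unfolding compact_pieces_def by (intro piece_dist_triangle) blast+
    ultimately show "piece_dist p (g (f p)) < 2 * \<epsilon>" by linarith
  qed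
qed

lemma close_translate_self:
  assumes "compact_pieces T" "norm x < \<epsilon>"
  shows "close \<epsilon> T (translate T x)"
  unfolding close_def
proof (intro exI conjI ballI impI)
  show "bij_betw (shift x) T (translate T x)"
    by (simp add: bij_betw_def inj_shift translate_def)
  show "piece_dist p (shift x p) < \<epsilon>" if "p \<in> T" for p
    using piece_dist_shift_self[of p x] assms that by (auto simp: compact_pieces_def)
qed auto

lemma close_translate:
  assumes "close \<delta> S T" "\<delta> \<le> \<epsilon>" "1/\<epsilon> + norm x \<le> 1/\<delta>"
  shows "close \<epsilon> (translate S x) (translate T x)"
proof -
  obtain A B f where f: "A \<subseteq> S" "B \<subseteq> T" "bij_betw f A B"
    "\<And>p. p \<in> S \<Longrightarrow> fst p \<inter> cball 0 (1/\<delta>) \<noteq> {} \<Longrightarrow> p \<in> A"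
    "\<And>q. q \<in> T \<Longrightarrow> fst q \<inter> cball 0 (1/\<delta>) \<noteq> {} \<Longrightarrow> q \<in> B"
    "\<And>p. p \<in> A \<Longrightarrow> piece_dist p (f p) < \<delta>"
    using assms(1) unfolding close_def by blast
  have meets: "fst p \<inter> cball 0 (1/\<delta>) \<noteq> {}" if shifted: "fst (shift x p) \<inter> cball 0 (1/\<epsilon>) \<noteq> {}" for p :: "('a, 'c) piece"
  proof -
    obtain a where a: "a \<in> fst p" "norm (a - x) \<le> 1/\<epsilon>"
      using shifted by (auto simp: shift_def)
    then have "norm a \<le> 1/\<delta>"
      using norm_triangle_sub[of a x] assms(3) by linarith
    then show ?thesis using a(1) by auto
  qed
  show ?thesis
    unfolding close_def
  proof (intro exI conjI ballI impI)
    show "shift x ` A \<subseteq> translate S x" "shift x ` B \<subseteq> translate T x"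
      using f(1,2) by (auto simp: translate_def)
    have "bij_betw (shift (- x)) (shift x ` A) A"
      unfolding bij_betw_def using inj_shift by (simp add: image_image)
    moreover have "bij_betw (shift x) B (shift x ` B)"
      unfolding bij_betw_def using inj_shift by simp
    ultimately show "bij_betw (shift x \<circ> (f \<circ> shift (- x))) (shift x ` A) (shift x ` B)"
      using f(3) bij_betw_trans by blast
    show "p \<in> shift x ` A" if "p \<in> translate S x" "fst p \<inter> cball 0 (1/\<epsilon>) \<noteq> {}" for p
      using that meets f(4) unfolding translate_def by blast
    show "p \<in> shift x ` B" if "p \<in> translate T x" "fst p \<inter> cball 0 (1/\<epsilon>) \<noteq> {}" for p
      using that meets f(5) unfolding translate_def by blast
    show "piece_dist p ((shift x \<circ> (f \<circ> shift (- x))) p) < \<epsilon>" if "p \<in> shift x ` A" for p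
      using that f(6) assms(2) by (fastforce simp: piece_dist_shift)
  qed
qed

section \<open>The pattern topology\<close>

text \<open>
  A point \<open>z\<close> near \<open>x\<close> outside \<open>Q\<close> is separated from \<open>Q\<close> by a hyperplane; moving from \<open>z\<close> away from \<open>Q\<close> by the
  length \<open>e\<close> stays inside \<open>P\<close> and reaches a point at distance more than \<open>e\<close> from \<open>Q\<close>.
  Without convexity \<open>Q\<close> could have a hole at \<open>x\<close>.
\<close>

lemma interior_stable_convex:
  fixes P Q :: "'a::euclidean_space set"
  assumes "ball x (2 * e) \<subseteq> P" "0 < e" "convex Q" "compact Q" "Q \<noteq> {}"
    and near: "\<And>w. w \<in> P \<Longrightarrow> infdist w Q < e"
  shows "x \<in> interior Q"
proof -
  have "ball x e \<subseteq> Q"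
  proof
    fix z assume z: "z \<in> ball x e"
    show "z \<in> Q"
    proof (rule ccontr)
      assume "z \<notin> Q"
      then obtain a b where ab: "inner a z < b" "\<And>y. y \<in> Q \<Longrightarrow> inner a y > b"
        using separating_hyperplane_closed_point[of Q z] assms compact_imp_closed by blast
      have "a \<noteq> 0" using ab \<open>Q \<noteq> {}\<close> by (metis equals0I inner_zero_left less_asym)
      define w where "w = z - (e / norm a) *\<^sub>R a"
      have "norm (z - w) = e"
        using \<open>a \<noteq> 0\<close> \<open>0 < e\<close> by (simp add: w_def)
      then have "dist x w < 2 * e"
        using z dist_triangle[of x w z] by (simp add: dist_norm)
      then have "w \<in> P" using assms(1) by auto
      obtain y where y: "y \<in> Q" "infdist w Q = dist w y"
        using infdist_attains_inf[of Q w] assms compact_imp_closed by blast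
      have "e * norm a < inner a (y - w)"
        using ab(1) ab(2)[OF y(1)] \<open>a \<noteq> 0\<close>
        by (simp add: w_def inner_diff_right dot_square_norm power2_eq_square)
      also have "\<dots> \<le> norm a * dist w y"
        using Cauchy_Schwarz_ineq2[of a "y - w"] by (simp add: dist_norm norm_minus_commute)
      finally have "e < dist w y"
        using \<open>a \<noteq> 0\<close> by (simp add: mult.commute)
      then show False
        using near[OF \<open>w \<in> P\<close>] y(2) by simp
    qed
  qed
  then show ?thesis
    using \<open>0 < e\<close> by (meson centre_in_ball interior_maximal open_ball subsetD)
qed

lemma is_tilingD:
  assumes "is_tiling T" "p \<in> T"
  shows "polytope (fst p)" "interior (fst p) \<noteq> {}"
    and "q \<in> T \<Longrightarrow> p \<noteq> q \<Longrightarrow> fst p \<inter> fst q \<subseteq> frontier (fst p)"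
  using assms by (simp_all add: is_tiling_def is_tile_def)

lemma tiling_space_compact_pieces:
  assumes "tiling_space \<Omega>" "T \<in> \<Omega>"
  shows "compact_pieces T"
proof -
  consider "is_tiling T" | "is_labelled_delone T"
    using assms unfolding tiling_space_def by blast
  then show ?thesis
  proof cases
    case 1
    then show ?thesis
      unfolding compact_pieces_def using is_tilingD(1,2) polytope_imp_compact interior_empty by metis
  next
    case 2
    then show ?thesis
      unfolding is_labelled_delone_def compact_pieces_def by auto
  qed
qed

text \<open>
  Pieces of one pattern cannot accumulate at a piece \<open>p\<close>.  For tilings, an interior point of \<open>p\<close>
  remains interior to every tile sufficiently close to \<open>p\<close>, and tiles have disjoint interiors.  For
  Delone sets this is uniform discreteness.
\<close>

lemma piece_isolated:
  assumes "tiling_space \<Omega>" "T \<in> \<Omega>" "S \<in> \<Omega>" "p \<in> T"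
  obtains \<eta> where "\<eta> > 0"
    "\<And>q q'. q \<in> S \<Longrightarrow> q' \<in> S \<Longrightarrow> piece_dist p q < \<eta> \<Longrightarrow> piece_dist p q' < \<eta> \<Longrightarrow> q = q'"
proof -
  have "(\<forall>T\<in>\<Omega>. is_tiling T) \<or> (\<forall>T\<in>\<Omega>. is_labelled_delone T)"
    using assms(1) unfolding tiling_space_def by (elim conjE disjE) simp_all
  then consider (tiling) "is_tiling T" "is_tiling S" | (delone) "is_labelled_delone T" "is_labelled_delone S"
    using assms(2,3) by (elim disjE) simp_all
  then show ?thesis
  proof cases
    case tiling
    have tile: "compact (fst q)" "fst q \<noteq> {}" "convex (fst q)" if "q \<in> S \<union> T" for q
    proof -
      have "polytope (fst q)" "interior (fst q) \<noteq> {}"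
        using that tiling is_tilingD by blast+
      then show "compact (fst q)" "fst q \<noteq> {}" "convex (fst q)"
        using polytope_imp_compact polytope_imp_convex by auto
    qed
    obtain x where "x \<in> interior (fst p)"
      using is_tilingD(2)[OF tiling(1) assms(4)] by blast
    then obtain e where e: "e > 0" "ball x e \<subseteq> fst p"
      by (meson interior_subset open_contains_ball open_interior subset_trans)
    have inside: "x \<in> interior (fst q)" if "q \<in> S" "piece_dist p q < e / 2" for q
    proof (rule interior_stable_convex[of x "e / 2" "fst p"])
      show "infdist w (fst q) < e / 2" if "w \<in> fst p" for w
        using piece_dist_infdist[of p q w] tile[of p] tile[of q] that assms(4) \<open>q \<in> S\<close> \<open>piece_dist p q < e / 2\<close>
        by simp
    qed (use e tile that in auto)
    show ?thesis
    proof (rule that[of "e / 2"])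
      show "e / 2 > 0" using e(1) by simp
      fix q q' assume q: "q \<in> S" "q' \<in> S" "piece_dist p q < e / 2" "piece_dist p q' < e / 2"
      show "q = q'"
      proof (rule ccontr)
        assume "q \<noteq> q'"
        then have "fst q \<inter> fst q' \<subseteq> frontier (fst q)"
          using is_tilingD(3)[OF tiling(2) q(1,2)] by blast
        then show False
          using inside[OF q(1,3)] inside[OF q(2,4)] interior_subset unfolding frontier_def by blast
      qed
    qed
  next
    case delone
    obtain Y lab where S: "uniformly_discrete Y" "S = (\<lambda>x. ({x}, lab x)) ` Y"
      using delone(2) unfolding is_labelled_delone_def by blast
    obtain r where r: "r > 0" "\<And>x y. x \<in> Y \<Longrightarrow> y \<in> Y \<Longrightarrow> x \<noteq> y \<Longrightarrow> r \<le> dist x y"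
      using S(1) unfolding uniformly_discrete_def by blast
    obtain x where x: "fst p = {x}"
      using delone(1) assms(4) unfolding is_labelled_delone_def by auto
    have near: "dist x y < r / 2" if "piece_dist p ({y}, l) < r / 2" for y l
      using piece_dist_infdist[of p "({y}, l)" x] that x by simp
    show ?thesis
    proof (rule that[of "r / 2"])
      show "r / 2 > 0" using r(1) by simp
      fix q q' assume q: "q \<in> S" "q' \<in> S" "piece_dist p q < r / 2" "piece_dist p q' < r / 2"
      then obtain y y' where y: "y \<in> Y" "q = ({y}, lab y)" "y' \<in> Y" "q' = ({y'}, lab y')"
        using S(2) by blast
      have "dist y y' < r"
        using near q(3,4) y dist_triangle_half_r[of x y r y'] by (metis dist_commute)
      then show "q = q'" using r(2)[of y y'] y by force
    qed
  qed
qed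

text \<open>
  Every piece \<open>p\<close> of \<open>T\<close> is approximated arbitrarily well by pieces of \<open>S\<close>; by isolation all good
  approximations are the same piece, which is then at distance zero from \<open>p\<close>.
\<close>

lemma all_close_imp_subset:
  assumes "tiling_space \<Omega>" "T \<in> \<Omega>" "S \<in> \<Omega>" and close: "\<And>\<epsilon>. \<epsilon> > 0 \<Longrightarrow> close \<epsilon> T S"
  shows "T \<subseteq> S"
proof
  fix p assume p: "p \<in> T"
  have pieces: "compact_pieces T" "compact_pieces S"
    using assms tiling_space_compact_pieces by blast+
  obtain \<eta> where \<eta>: "\<eta> > 0"
    "\<And>q q'. q \<in> S \<Longrightarrow> q' \<in> S \<Longrightarrow> piece_dist p q < \<eta> \<Longrightarrow> piece_dist p q' < \<eta> \<Longrightarrow> q = q'"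
    using piece_isolated[OF assms(1,2,3) p] by blast
  obtain a where a: "a \<in> fst p" using pieces p by (auto simp: compact_pieces_def)
  have ex: "\<exists>q\<in>S. piece_dist p q < \<epsilon>" if "\<epsilon> > 0" for \<epsilon>
  proof -
    define \<delta> where "\<delta> = min \<epsilon> (1 / (norm a + 1))"
    have \<delta>: "\<delta> > 0" "\<delta> \<le> \<epsilon>" "\<delta> \<le> 1 / (norm a + 1)"
      using that by (auto simp: \<delta>_def add_nonneg_pos)
    have "1 / (1 / (norm a + 1)) \<le> 1 / \<delta>"
      using \<delta> by (intro divide_left_mono) (auto simp: add_nonneg_pos)
    then have "norm a \<le> 1 / \<delta>" by simp
    then have meets: "fst p \<inter> cball 0 (1 / \<delta>) \<noteq> {}" using a by auto
    obtain A B f where "B \<subseteq> S" "bij_betw f A B"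
      "\<forall>p\<in>T. fst p \<inter> cball 0 (1/\<delta>) \<noteq> {} \<longrightarrow> p \<in> A" "\<forall>p\<in>A. piece_dist p (f p) < \<delta>"
      using close[OF \<delta>(1)] unfolding close_def by blast
    then have "f p \<in> S" "piece_dist p (f p) < \<delta>"
      using p meets bij_betwE by blast+
    then show ?thesis using \<delta>(2) by force
  qed
  then obtain q where q: "q \<in> S" "piece_dist p q < \<eta>" using \<eta>(1) by blast
  have "piece_dist p q \<le> 0"
  proof (rule field_le_epsilon)
    fix \<epsilon> :: real assume "\<epsilon> > 0"
    then obtain q' where "q' \<in> S" "piece_dist p q' < min \<epsilon> \<eta>"
      using ex[of "min \<epsilon> \<eta>"] \<eta>(1) by auto
    then show "piece_dist p q \<le> 0 + \<epsilon>"
      using \<eta>(2)[of q q'] q by auto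
  qed
  then have "p = q"
    using piece_dist_le_0_imp_eq[of p q] pieces p q(1) by (auto simp: compact_pieces_def)
  then show "p \<in> S" using q(1) by simp
qed

text \<open>
  The patterns \<open>\<epsilon>\<close>-close to \<open>T\<close> need not form an open set, but they contain one: the patterns all of
  whose sufficiently close neighbours are \<open>\<epsilon>\<close>-close to \<open>T\<close>.
\<close>

lemma close_neighbourhood:
  assumes "tiling_space \<Omega>" "T \<in> \<Omega>" "\<epsilon> > 0"
  obtains V where "openin (pattern_topology \<Omega>) V" "T \<in> V" "\<And>S. S \<in> V \<Longrightarrow> S \<in> \<Omega> \<and> close \<epsilon> T S"
proof -
  note pieces = tiling_space_compact_pieces[OF assms(1)]
  define V where "V = {S \<in> \<Omega>. \<exists>\<delta>>0. \<forall>R\<in>\<Omega>. close \<delta> S R \<longrightarrow> close \<epsilon> T R}"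
  have "openin (pattern_topology \<Omega>) V"
    unfolding openin_pattern_topology
  proof (intro conjI ballI)
    show "V \<subseteq> \<Omega>" by (auto simp: V_def)
    fix S assume "S \<in> V"
    then obtain \<delta> where S: "S \<in> \<Omega>" and \<delta>: "\<delta> > 0" "\<And>R. R \<in> \<Omega> \<Longrightarrow> close \<delta> S R \<Longrightarrow> close \<epsilon> T R"
      by (auto simp: V_def)
    define \<eta> where "\<eta> = min (\<delta> / 2) (1 / 2)"
    have \<eta>: "\<eta> > 0" "\<eta> \<le> 1/2" "2 * \<eta> \<le> \<delta>" using \<delta>(1) by (auto simp: \<eta>_def)
    have "S' \<in> V" if S': "S' \<in> \<Omega>" "close \<eta> S S'" for S'
    proof -
      have "close \<epsilon> T R" if R: "R \<in> \<Omega>" "close \<eta> S' R" for R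
      proof -
        have "close (2 * \<eta>) S R"
          using close_trans[OF pieces pieces pieces S'(2) R(2)] S S' R \<eta> by blast
        then show ?thesis
          using close_mono[of "2 * \<eta>" S R \<delta>] \<delta>(2) R(1) \<eta> by simp
      qed
      then show ?thesis unfolding V_def using S'(1) \<eta>(1) by blast
    qed
    then show "\<exists>\<epsilon>>0. \<forall>S'\<in>\<Omega>. close \<epsilon> S S' \<longrightarrow> S' \<in> V" using \<eta>(1) by blast
  qed
  moreover have "T \<in> V" using assms by (auto simp: V_def)
  moreover have "S \<in> \<Omega> \<and> close \<epsilon> T S" if "S \<in> V" for S
    using that close_refl pieces by (auto simp: V_def)
  ultimately show ?thesis using that by blast
qed

lemma Hausdorff_pattern_topology:
  assumes "tiling_space \<Omega>"
  shows "Hausdorff_space (pattern_topology \<Omega>)"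
  unfolding Hausdorff_space_def
proof (intro allI impI)
  note pieces = tiling_space_compact_pieces[OF assms]
  fix S T assume ST: "S \<in> topspace (pattern_topology \<Omega>) \<and> T \<in> topspace (pattern_topology \<Omega>) \<and> S \<noteq> T"
  then have in_\<Omega>: "S \<in> \<Omega>" "T \<in> \<Omega>" by simp_all
  have "\<exists>\<epsilon>>0. \<not> close \<epsilon> S T"
  proof (rule ccontr)
    assume "\<not> (\<exists>\<epsilon>>0. \<not> close \<epsilon> S T)"
    then have "S \<subseteq> T" "T \<subseteq> S"
      using all_close_imp_subset[OF assms] in_\<Omega> close_sym by blast+
    then show False using ST by blast
  qed
  then obtain \<epsilon> where \<epsilon>: "\<epsilon> > 0" "\<not> close \<epsilon> S T" by blast
  define \<eta> where "\<eta> = min (\<epsilon> / 2) (1 / 2)"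
  have \<eta>: "\<eta> > 0" "\<eta> \<le> 1/2" "2 * \<eta> \<le> \<epsilon>" using \<epsilon>(1) by (auto simp: \<eta>_def)
  obtain U where U: "openin (pattern_topology \<Omega>) U" "S \<in> U" "\<And>R. R \<in> U \<Longrightarrow> R \<in> \<Omega> \<and> close \<eta> S R"
    using close_neighbourhood[OF assms in_\<Omega>(1) \<eta>(1)] by blast
  obtain V where V: "openin (pattern_topology \<Omega>) V" "T \<in> V" "\<And>R. R \<in> V \<Longrightarrow> R \<in> \<Omega> \<and> close \<eta> T R"
    using close_neighbourhood[OF assms in_\<Omega>(2) \<eta>(1)] by blast
  have "disjnt U V"
  proof (rule ccontr)
    assume "\<not> disjnt U V"
    then obtain R where R: "R \<in> U" "R \<in> V" by (auto simp: disjnt_iff)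
    have "close (2 * \<eta>) S T"
      using close_trans[OF pieces pieces pieces, of S R T \<eta>] U(3)[OF R(1)] V(3)[OF R(2)] in_\<Omega> \<eta> close_sym
      by blast
    then show False
      using close_mono[of "2 * \<eta>" S T \<epsilon>] \<eta> \<epsilon>(2) by simp
  qed
  then show "\<exists>U V. openin (pattern_topology \<Omega>) U \<and> openin (pattern_topology \<Omega>) V \<and> S \<in> U \<and> T \<in> V \<and> disjnt U V"
    using U V by blast
qed

text \<open>
  For \<open>(S, y)\<close> near \<open>(T, x)\<close>, compare \<open>T - x\<close> with \<open>S - x\<close> and \<open>S - x\<close> with \<open>S - y\<close>.  The first step
  requires \<open>S\<close> to resemble \<open>T\<close> on a ball enlarged by \<open>norm x\<close>, since translation moves the origin;
  the second moves all pieces by \<open>y - x\<close>.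
\<close>

lemma continuous_map_translate:
  assumes "tiling_space \<Omega>"
  shows "continuous_map (prod_topology (pattern_topology \<Omega>) euclidean) (pattern_topology \<Omega>)
    (\<lambda>(T, x). translate T x)"
proof -
  note pieces = tiling_space_compact_pieces[OF assms]
  have trans_in: "translate T x \<in> \<Omega>" if "T \<in> \<Omega>" for T x
    using assms that by (auto simp: tiling_space_def)
  show ?thesis
    unfolding continuous_map_def
  proof (intro conjI allI impI)
    show "(\<lambda>(T, x). translate T x) \<in> topspace (prod_topology (pattern_topology \<Omega>) euclidean) \<rightarrow> topspace (pattern_topology \<Omega>)"
      using trans_in by auto
    fix U assume U: "openin (pattern_topology \<Omega>) U"
    show "openin (prod_topology (pattern_topology \<Omega>) euclidean)
      {z \<in> topspace (prod_topology (pattern_topology \<Omega>) euclidean). (case z of (T, x) \<Rightarrow> translate T x) \<in> U}"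
      (is "openin _ ?W")
      unfolding openin_prod_topology_alt
    proof (intro allI impI)
      fix T x assume "(T, x) \<in> ?W"
      then have T: "T \<in> \<Omega>" "translate T x \<in> U" by auto
      then obtain \<epsilon> where \<epsilon>: "\<epsilon> > 0" "\<And>S. S \<in> \<Omega> \<Longrightarrow> close \<epsilon> (translate T x) S \<Longrightarrow> S \<in> U"
        using U unfolding openin_pattern_topology by blast
      define \<eta> where "\<eta> = min (\<epsilon> / 2) (1 / 2)"
      have \<eta>: "\<eta> > 0" "\<eta> \<le> 1/2" "2 * \<eta> \<le> \<epsilon>" using \<epsilon>(1) by (auto simp: \<eta>_def)
      define \<delta> where "\<delta> = 1 / (1 / \<eta> + norm x)"
      have \<delta>: "\<delta> > 0" "\<delta> \<le> \<eta>" "1/\<eta> + norm x \<le> 1/\<delta>"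
      proof -
        have "1 / \<eta> + norm x > 0" using \<eta>(1) by (simp add: add_pos_nonneg)
        then show "\<delta> > 0" by (simp add: \<delta>_def)
        have "1 / (1 / \<eta> + norm x) \<le> 1 / (1 / \<eta>)"
          using \<eta>(1) \<open>1 / \<eta> + norm x > 0\<close> by (intro divide_left_mono) auto
        then show "\<delta> \<le> \<eta>" by (simp add: \<delta>_def)
      qed (simp add: \<delta>_def)
      obtain V where V: "openin (pattern_topology \<Omega>) V" "T \<in> V" "\<And>S. S \<in> V \<Longrightarrow> S \<in> \<Omega> \<and> close \<delta> T S"
        using close_neighbourhood[OF assms T(1) \<delta>(1)] by blast
      have "V \<times> ball x \<eta> \<subseteq> ?W"
      proof
        fix z assume "z \<in> V \<times> ball x \<eta>"
        then obtain S y where z: "z = (S, y)" "S \<in> V" "dist x y < \<eta>" by auto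
        have S: "S \<in> \<Omega>" "close \<delta> T S" using V(3) z(2) by blast+
        have "close \<eta> (translate T x) (translate S x)"
          using close_translate[OF S(2) \<delta>(2,3)] .
        moreover have "close \<eta> (translate S x) (translate S y)"
          using close_translate_self[of "translate S x" "y - x" \<eta>] pieces[OF trans_in[OF S(1), of x]] z(3)
          by (simp add: translate_translate dist_norm norm_minus_commute)
        ultimately have "close (2 * \<eta>) (translate T x) (translate S y)"
          using close_trans[OF pieces pieces pieces] trans_in T(1) S(1) \<eta> by blast
        then have "close \<epsilon> (translate T x) (translate S y)"
          using close_mono[of "2 * \<eta>"] \<eta> by simp
        then show "z \<in> ?W"
          using \<epsilon>(2) trans_in S(1) z(1) by simp
      qed
      then show "\<exists>U V. openin (pattern_topology \<Omega>) U \<and> openin euclidean V \<and> T \<in> U \<and> x \<in> V \<and> U \<times> V \<subseteq> ?W"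
        using V(1,2) \<eta>(1) by (intro exI[of _ V] exI[of _ "ball x \<eta>"]) auto
    qed
  qed
qed

lemma flow_tiling_space:
  assumes "tiling_space \<Omega>"
  shows "flow (pattern_topology \<Omega>) translate"
  using assms Hausdorff_pattern_topology continuous_map_translate
  by (auto simp: flow_def tiling_space_def translate_0 translate_translate)

section \<open>Orbit equivalences of tiling spaces\<close>

lemma displacement_eqI:
  assumes "aperiodic \<Omega>'" "S \<in> \<Omega>'" and trans: "\<And>x. translate S x \<in> \<Omega>'"
    and "h T = S" "h (translate T x) \<in> orbit S"
  shows "h (translate T x) = translate (h T) (displacement h T x)"
proof -
  obtain y where y: "h (translate T x) = translate S y"
    using assms(5) by (auto simp: orbit_def)
  have "z = y" if "h (translate T x) = translate S z" for z
  proof -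
    have "translate (translate S z) (y - z) = translate S z"
      using that y by (simp add: translate_translate)
    then have "y - z = 0"
      using assms(1) trans unfolding aperiodic_def by blast
    then show ?thesis by simp
  qed
  then show ?thesis
    unfolding displacement_def assms(4) using theI[of "\<lambda>y. h (translate T x) = translate S y", OF y] by blast
qed

lemma tiling_space_translate: "tiling_space \<Omega> \<Longrightarrow> T \<in> \<Omega> \<Longrightarrow> translate T x \<in> \<Omega>"
  by (simp add: tiling_space_def)

lemma free_flow_tiling_space:
  assumes "tiling_space \<Omega>" "aperiodic \<Omega>"
  shows "free_flow (pattern_topology \<Omega>) translate"
  using flow_tiling_space[OF assms(1)] assms(2)
  by (simp add: free_flow_def free_flow_axioms_def aperiodic_def)

lemma orbit_map_displacement:
  assumes "tiling_space \<Omega>" "tiling_space \<Omega>'" "aperiodic \<Omega>'"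
    and cont: "continuous_map (pattern_topology \<Omega>) (pattern_topology \<Omega>') h"
    and orbits: "\<And>T x. T \<in> \<Omega> \<Longrightarrow> h (translate T x) \<in> orbit (h T)"
  shows "orbit_map (pattern_topology \<Omega>) translate (pattern_topology \<Omega>') translate h (displacement h)"
proof -
  have "h T \<in> \<Omega>'" if "T \<in> \<Omega>" for T
    using continuous_map_image_subset_topspace[OF cont] that by auto
  then have "h (translate T x) = translate (h T) (displacement h T x)" if "T \<in> \<Omega>" for T x
    using displacement_eqI[OF assms(3)] tiling_space_translate[OF assms(2)] orbits that by blast
  then show ?thesis
    using flow_tiling_space[OF assms(1)] free_flow_tiling_space[OF assms(2,3)] cont
    by (simp add: orbit_map_def orbit_map_axioms_def)
qed

theorem theorem7p1:
  fixes \<Omega> :: "('n::finite, 'l::metric_space) pattern set"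
    and \<Omega>' :: "('n, 'm::metric_space) pattern set"
    and h :: "('n, 'l) pattern \<Rightarrow> ('n, 'm) pattern"
    and \<mu> :: "('n, 'l) pattern measure"
  assumes "tiling_space \<Omega>" and "minimal \<Omega>" and "aperiodic \<Omega>"
    and "tiling_space \<Omega>'" and "minimal \<Omega>'" and "aperiodic \<Omega>'"
    and "orbit_equivalence \<Omega> \<Omega>' h"
    and "uniquely_ergodic \<Omega>" and "invariant_prob \<Omega> \<mu>"
  shows "invertible (matrix (ruelle_sullivan \<mu> (oe_class \<Omega> h)))"
proof -
  let ?X = "pattern_topology \<Omega>" and ?X' = "pattern_topology \<Omega>'"
  let ?\<alpha> = "displacement h"
  have homeo: "homeomorphic_map ?X ?X' h" and orbits: "\<And>T. T \<in> \<Omega> \<Longrightarrow> h ` orbit T = orbit (h T)"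
    using assms(7) by (simp_all add: orbit_equivalence_def)
  then obtain g where g: "homeomorphic_maps ?X ?X' h g"
    using homeomorphic_map_maps by blast
  have cont: "continuous_map ?X ?X' h" "continuous_map ?X' ?X g"
    and inverse: "\<And>T. T \<in> \<Omega> \<Longrightarrow> g (h T) = T" "\<And>S. S \<in> \<Omega>' \<Longrightarrow> h (g S) = S"
    using g by (simp_all add: homeomorphic_maps_def)
  have g_in: "g S \<in> \<Omega>" if "S \<in> \<Omega>'" for S
    using continuous_map_image_subset_topspace[OF cont(2)] that by auto
  interpret forward: orbit_map ?X translate ?X' translate h ?\<alpha>
  proof (rule orbit_map_displacement[OF assms(1,4,6) cont(1)])
    show "h (translate T x) \<in> orbit (h T)" if "T \<in> \<Omega>" for T x
      using orbits[OF that] unfolding orbit_def by blast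
  qed
  interpret backward: orbit_map ?X' translate ?X translate g "displacement g"
  proof (rule orbit_map_displacement[OF assms(4,1,3) cont(2)])
    fix S x assume S: "S \<in> \<Omega>'"
    then have "translate S x \<in> h ` orbit (g S)"
      using orbits[OF g_in[OF S]] inverse(2)[OF S] by (simp add: orbit_def)
    then obtain y where "translate S x = h (translate (g S) y)"
      by (auto simp: orbit_def)
    then show "g (translate S x) \<in> orbit (g S)"
      using inverse(1)[OF tiling_space_translate[OF assms(1) g_in[OF S]]] by (simp add: orbit_def)
  qed
  \<comment> \<open>Since \<open>\<Omega>\<close> is aperiodic, the displacement of the inverse undoes that of \<open>h\<close>.\<close>
  have round_trip: "displacement g (h T) (?\<alpha> T x) = x" if "T \<in> \<Omega>" for T x
  proof -
    have "g (translate (h T) (?\<alpha> T x)) = translate T x"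
      using inverse(1)[OF tiling_space_translate[OF assms(1) that]] forward.intertwines[of T x] that
      by (metis topspace_pattern_topology)
    then show ?thesis
      using backward.displacement_eq_iff[of "h T" x "?\<alpha> T x"] forward.h_in_topspace[of T] inverse(1)[OF that] that
      by simp
  qed
  obtain K where "K > 0" and growth: "\<And>T x. T \<in> topspace ?X \<Longrightarrow> norm (?\<alpha> T x) \<le> K * (norm x + 1)"
    using forward.displacement_linear_growth by blast
  obtain L where "L > 0" and "\<And>S x. S \<in> topspace ?X' \<Longrightarrow> norm (displacement g S x) \<le> L * (norm x + 1)"
    using backward.displacement_linear_growth by blast
  then have expansion: "norm x \<le> L * (norm (?\<alpha> T x) + 1)" if "T \<in> topspace ?X" for T x
    using round_trip[of T x] forward.h_in_topspace[OF that] that by (metis topspace_pattern_topology)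
  have inv_iff: "forward.source.invariant_probability \<nu> \<longleftrightarrow> invariant_prob \<Omega> \<nu>" for \<nu>
    by (simp add: forward.source.invariant_probability_def invariant_prob_def)
  interpret uniquely_ergodic_flow ?X translate \<mu>
  proof unfold_locales
    show "forward.source.invariant_probability \<mu>"
      using assms(9) inv_iff by blast
    show "\<nu> = \<mu>" if "forward.source.invariant_probability \<nu>" for \<nu>
      using assms(8,9) that inv_iff unfolding uniquely_ergodic_def by blast
  qed
  have cont_\<alpha>: "continuous_map ?X euclidean (\<lambda>T. ?\<alpha> T x)" for x
    using continuous_map_compose[OF continuous_map_pairedI[OF continuous_map_id] forward.continuous_displacement, of "\<lambda>_. x"]
    by (simp add: o_def)
  have weak: "weak_cocycle \<Omega> ?\<alpha>"
    unfolding weak_cocycle_def using forward.continuous_displacement forward.cocycle by simp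
  let ?\<rho> = "\<lambda>v. \<integral>T. ?\<alpha> T v \<partial>\<mu>"
  \<comment> \<open>A coboundary integrates to zero by invariance, so the displacement represents its class.\<close>
  have "ruelle_sullivan \<mu> (oe_class \<Omega> h) = ?\<rho>"
    unfolding ruelle_sullivan_def
  proof (rule the_equality)
    show "\<forall>\<beta>\<in>oe_class \<Omega> h. ?\<rho> = (\<lambda>v. \<integral>T. \<beta> T v \<partial>\<mu>)"
    proof (intro ballI ext)
      fix \<beta> v assume "\<beta> \<in> oe_class \<Omega> h"
      then obtain s where s: "continuous_map ?X euclidean s"
        "\<And>T. T \<in> \<Omega> \<Longrightarrow> \<beta> T v - ?\<alpha> T v = s (translate T v) - s T"
        by (auto simp: oe_class_def cohomologous_def weak_coboundary_def)
      have int: "integrable \<mu> s" "integrable \<mu> (\<lambda>T. s (translate T v))" "integrable \<mu> (\<lambda>T. ?\<alpha> T v)"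
        using continuous_map_integrable[OF s(1)] continuous_map_integrable[OF cont_\<alpha>]
          integrable_distr[OF act_measurable, of v s] by (simp_all add: distr_act)
      have "(\<integral>T. \<beta> T v \<partial>\<mu>) = (\<integral>T. ?\<alpha> T v + (s (translate T v) - s T) \<partial>\<mu>)"
        using s(2) by (intro Bochner_Integration.integral_cong) (auto simp: space_\<mu> algebra_simps)
      also have "\<dots> = (\<integral>T. ?\<alpha> T v \<partial>\<mu>)"
        using int integral_act[of s v] by simp
      finally show "(\<integral>T. ?\<alpha> T v \<partial>\<mu>) = (\<integral>T. \<beta> T v \<partial>\<mu>)" ..
    qed
    have "?\<alpha> \<in> oe_class \<Omega> h"
      unfolding oe_class_def using weak equiv_class_self[OF equiv_cohomologous, of ?\<alpha>] by simp
    then show "C = ?\<rho>" if "\<forall>\<beta>\<in>oe_class \<Omega> h. C = (\<lambda>v. \<integral>T. \<beta> T v \<partial>\<mu>)" for C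
      using that by blast
  qed
  moreover have linear: "linear ?\<rho>"
    by (rule linear_mean_displacement[OF cont_\<alpha> forward.cocycle growth])
  moreover have "?\<rho> v \<noteq> 0" if "v \<noteq> 0" for v
    by (rule mean_displacement_nonzero[OF cont_\<alpha> forward.cocycle expansion that])
  then have "inj ?\<rho>"
    using linear linear_injective_0 by blast
  then have "inj ((*v) (matrix ?\<rho>))"
    using linear by (simp add: matrix_works inj_on_def)
  ultimately show ?thesis
    by (simp add: invertible_left_inverse matrix_left_invertible_injective)
qed

end
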